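(* Let $E$ be an ordered and weakly sequentially complete Banach space whose positive cone $K$ is normal, let $\omega>0$ and $\tau>0$, let $A:D(A)\subset E\to E$ be a closed linear operator such that $-A$ generates a positive equicontinuous $C_0$-semigroup $T(t)$ $(t\ge 0)$ on $E$, and let $F:\mathbb{R}\times E\times E\to E$ be a continuous mapping which is $\omega$-periodic in $t$. Assume that the delayed evolution equation $$u'(t)+Au(t)=F(t,u(t),u(t-\tau)),\qquad t\in\mathbb{R},$$ has an $\omega$-periodic lower solution $v_0$ and an $\omega$-periodic upper solution $w_0$, $v_0,w_0\in C^1_\omega(\mathbb{R},E)\cap C_\omega(\mathbb{R},E_1)$, with $v_0\le w_0$. Suppose there exists a constant $C\ge 0$ such that for all $t\in\mathbb{R}$ and all $x_1,x_2,y_1,y_2\in E$ with $v_0(t)\le x_1\le x_2\le w_0(t)$ and $v_0(t-\tau)\le y_1\le y_2\le w_0(t-\tau)$, $$F(t,x_2,y_2)-F(t,x_1,y_1)\ge -C(x_2-x_1).$$ Then the equation has a minimal $\omega$-periodic mild solution $\underline{u}$ and a maximal $\omega$-periodic mild solution $\overline{u}$ between $v_0$ and $w_0$, and these can be obtained as limits of the monotone iterative sequences starting from $v_0$ and $w_0$, respectively.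
   Context: The cone is $K=\{u\in E: u\ge\theta\}$, $\theta$ the zero element; normal with constant $N$ means $\theta\le x\le y$ implies $\|x\|\le N\|y\|$. $C_\omega(\mathbb{R},E)$ is the Banach space of continuous $\omega$-periodic functions $u:\mathbb{R}\to E$ with norm $\|u\|_C=\max_{t\in[0,\omega]}\|u(t)\|$, ordered pointwise. $C^1_\omega(\mathbb{R},E)$ is the set of $C^1$ functions in $C_\omega(\mathbb{R},E)$. $E_1=D(A)$ with the graph norm $\|\cdot\|+\|A\cdot\|$. A $C_0$-semigroup $T(t)$ is positive if $T(t)x\ge\theta$ for all $x\ge\theta$, $t\ge0$; it is equicontinuous if $t\mapsto T(t)$ is continuous in the operator norm for $t>0$. Its growth exponent is $\nu_0=\inf\{\nu\in\mathbb{R}: \exists M\ge1,\ \|T(t)\|\le Me^{\nu t}\ \forall t\ge0\}$. A function $v_0\in C^1_\omega(\mathbb{R},E)\cap C_\omega(\mathbb{R},E_1)$ is an $\omega$-periodic lower solution if $v_0'(t)+Av_0(t)\le F(t,v_0(t),v_0(t-\tau))$ for all $t\in\mathbb{R}$; an $\omega$-periodic upper solution is defined with the inequality reversed. An $\omega$-periodic mild solution is $u\in C_\omega(\mathbb{R},E)$ with $u(t)=T(t-s)u(s)+\int_s^tT(t-r)F(r,u(r),u(r-\tau))\,dr$ for all $s\le t$. Minimal and maximal between $v_0$ and $w_0$ means: $v_0\le\underline{u}\le\overline{u}\le w_0$, and every $\omega$-periodic mild solution $u$ with $v_0\le u\le w_0$ satisfies $\underline{u}\le u\le\overline{u}$.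 Monotone iterative sequences: take a constant $C$ as in the hypothesis, enlarged if necessary so that $C>\nu_0$, put $S(t)=e^{-Ct}T(t)$ and $$(Qu)(t)=(I-S(\omega))^{-1}\int_{t-\omega}^tS(t-s)\big(F(s,u(s),u(s-\tau))+Cu(s)\big)\,ds .$$ The sequences are $v_i=Qv_{i-1}$, $w_i=Qw_{i-1}$ $(i\ge1)$; they satisfy $v_0\le v_1\le\cdots\le v_i\le\cdots\le w_i\le\cdots\le w_1\le w_0$, and "obtained" means $v_i\to\underline{u}$, $w_i\to\overline{u}$ in $C_\omega(\mathbb{R},E)$. *)

theory Defs
  imports "HOL-Analysis.Analysis"
begin

definition normal_cone :: "'a::{real_normed_vector, ordered_real_vector} set \<Rightarrow> bool" where
  "normal_cone K \<longleftrightarrow>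
     (\<exists>N>0. \<forall>x y. x \<in> K \<longrightarrow> y - x \<in> K \<longrightarrow> norm x \<le> N * norm y)"

definition weakly_sequentially_complete :: "'a::real_normed_vector set \<Rightarrow> bool" where
  "weakly_sequentially_complete S \<longleftrightarrow>
     (\<forall>x. range x \<subseteq> S \<longrightarrow> (\<forall>f :: 'a \<Rightarrow>\<^sub>L real. Cauchy (\<lambda>n. f (x n))) \<longrightarrow>
        (\<exists>l\<in>S. \<forall>f :: 'a \<Rightarrow>\<^sub>L real. (\<lambda>n. f (x n)) \<longlonglongrightarrow> f l))"


subsection \<open>Operators and semigroups\<close>

text \<open>An operator \<open>A : D(A) \<rightarrow> E\<close> is a total function \<open>A\<close> together with its domain \<open>D\<close>;
  values of \<open>A\<close> outside \<open>D\<close> are irrelevant. Similarly, a semigroup \<open>T\<close> is indexed by all reals,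
  but only its values at nonnegative times are ever used.\<close>

definition closed_linear_operator ::
    "'a::real_normed_vector set \<Rightarrow> ('a \<Rightarrow> 'a) \<Rightarrow> bool" where
  "closed_linear_operator D A \<longleftrightarrow>
     subspace D \<and>
     (\<forall>x\<in>D. \<forall>y\<in>D. A (x + y) = A x + A y) \<and>
     (\<forall>x\<in>D. \<forall>c. A (c *\<^sub>R x) = c *\<^sub>R A x) \<and>
     closed {(x, A x) | x. x \<in> D}"

definition C0_semigroup :: "(real \<Rightarrow> 'a::real_normed_vector \<Rightarrow>\<^sub>L 'a) \<Rightarrow> bool" where
  "C0_semigroup T \<longleftrightarrow>
     T 0 = id_blinfun \<and>
     (\<forall>s\<ge>0. \<forall>t\<ge>0. T (s + t) = T s o\<^sub>L T t) \<and>
     (\<forall>x. ((\<lambda>t. T t x) \<longlongrightarrow> x) (at_right 0))"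

text \<open>The graph of the generator consists of the pairs \<open>(x, y)\<close> for which the difference
  quotients at \<open>0\<close> converge to \<open>y\<close>; in particular \<open>D\<close> is the full domain of the generator.\<close>

definition generates ::
    "'a::real_normed_vector set \<Rightarrow> ('a \<Rightarrow> 'a) \<Rightarrow> (real \<Rightarrow> 'a \<Rightarrow>\<^sub>L 'a) \<Rightarrow> bool" where
  "generates D B T \<longleftrightarrow>
     (\<forall>x y. x \<in> D \<and> y = B x \<longleftrightarrow> ((\<lambda>h. (T h x - x) /\<^sub>R h) \<longlongrightarrow> y) (at_right 0))"

definition positive_semigroup ::
    "(real \<Rightarrow> 'a::{real_normed_vector, ordered_real_vector} \<Rightarrow>\<^sub>L 'a) \<Rightarrow> bool" where
  "positive_semigroup T \<longleftrightarrow> (\<forall>t\<ge>0. \<forall>x\<ge>0. T t x \<ge> 0)"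

definition equicontinuous_semigroup :: "(real \<Rightarrow> 'a::real_normed_vector \<Rightarrow>\<^sub>L 'a) \<Rightarrow> bool" where
  "equicontinuous_semigroup T \<longleftrightarrow> continuous_on {0<..} T"

text \<open>Extended-real valued, since the growth exponent is \<open>-\<infinity>\<close> for e.g. nilpotent semigroups.\<close>

definition growth_exponent :: "(real \<Rightarrow> 'a::real_normed_vector \<Rightarrow>\<^sub>L 'a) \<Rightarrow> ereal" where
  "growth_exponent T =
     Inf {ereal \<nu> | \<nu>. \<exists>M\<ge>1. \<forall>t\<ge>0. norm (T t) \<le> M * exp (\<nu> * t)}"


subsection \<open>Spaces of periodic functions\<close>

definition C_per :: "real \<Rightarrow> (real \<Rightarrow> 'a::real_normed_vector) set" where
  "C_per \<omega> = {u. continuous_on UNIV u \<and> (\<forall>t. u (t + \<omega>) = u t)}"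

definition norm_C :: "real \<Rightarrow> (real \<Rightarrow> 'a::real_normed_vector) \<Rightarrow> real" where
  "norm_C \<omega> u = (SUP t\<in>{0..\<omega>}. norm (u t))"

definition converges_in_C_per ::
    "real \<Rightarrow> (nat \<Rightarrow> real \<Rightarrow> 'a::real_normed_vector) \<Rightarrow> (real \<Rightarrow> 'a) \<Rightarrow> bool" where
  "converges_in_C_per \<omega> u l \<longleftrightarrow>
     range u \<subseteq> C_per \<omega> \<and> l \<in> C_per \<omega> \<and> (\<lambda>i. norm_C \<omega> (\<lambda>t. u i t - l t)) \<longlonglongrightarrow> 0"

definition C1_per :: "real \<Rightarrow> (real \<Rightarrow> 'a::real_normed_vector) set" where
  "C1_per \<omega> = {u \<in> C_per \<omega>. u C1_differentiable_on UNIV}"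

definition graph_norm :: "('a::real_normed_vector \<Rightarrow> 'a) \<Rightarrow> 'a \<Rightarrow> real" where
  "graph_norm A x = norm x + norm (A x)"

text \<open>The periodic functions that are continuous into \<open>D\<close> with the graph norm of \<open>A\<close>.\<close>

definition C_per_graph ::
    "real \<Rightarrow> 'a::real_normed_vector set \<Rightarrow> ('a \<Rightarrow> 'a) \<Rightarrow> (real \<Rightarrow> 'a) set" where
  "C_per_graph \<omega> D A =
     {u. range u \<subseteq> D \<and> (\<forall>t. ((\<lambda>s. graph_norm A (u s - u t)) \<longlongrightarrow> 0) (at t)) \<and>
         (\<forall>t. u (t + \<omega>) = u t)}"


subsection \<open>The delayed evolution equation\<close>

definition lower_solution ::
    "real \<Rightarrow> real \<Rightarrow> 'a::{banach, ordered_real_vector} set \<Rightarrow> ('a \<Rightarrow> 'a)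
      \<Rightarrow> (real \<times> 'a \<times> 'a \<Rightarrow> 'a) \<Rightarrow> (real \<Rightarrow> 'a) \<Rightarrow> bool" where
  "lower_solution \<omega> \<tau> D A F v \<longleftrightarrow>
     v \<in> C1_per \<omega> \<inter> C_per_graph \<omega> D A \<and>
     (\<forall>t. vector_derivative v (at t) + A (v t) \<le> F (t, v t, v (t - \<tau>)))"

definition upper_solution ::
    "real \<Rightarrow> real \<Rightarrow> 'a::{banach, ordered_real_vector} set \<Rightarrow> ('a \<Rightarrow> 'a)
      \<Rightarrow> (real \<times> 'a \<times> 'a \<Rightarrow> 'a) \<Rightarrow> (real \<Rightarrow> 'a) \<Rightarrow> bool" where
  "upper_solution \<omega> \<tau> D A F w \<longleftrightarrow>
     w \<in> C1_per \<omega> \<inter> C_per_graph \<omega> D A \<and>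
     (\<forall>t. vector_derivative w (at t) + A (w t) \<ge> F (t, w t, w (t - \<tau>)))"

definition mild_solution ::
    "real \<Rightarrow> real \<Rightarrow> (real \<Rightarrow> 'a::banach \<Rightarrow>\<^sub>L 'a) \<Rightarrow> (real \<times> 'a \<times> 'a \<Rightarrow> 'a)
      \<Rightarrow> (real \<Rightarrow> 'a) \<Rightarrow> bool" where
  "mild_solution \<omega> \<tau> T F u \<longleftrightarrow>
     u \<in> C_per \<omega> \<and>
     (\<forall>s t. s \<le> t \<longrightarrow>
        u t = T (t - s) (u s) + integral {s..t} (\<lambda>r. T (t - r) (F (r, u r, u (r - \<tau>)))))"

definition minimal_maximal_mild_solutions ::
    "real \<Rightarrow> real \<Rightarrow> (real \<Rightarrow> 'a::{banach, ordered_real_vector} \<Rightarrow>\<^sub>L 'a)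
      \<Rightarrow> (real \<times> 'a \<times> 'a \<Rightarrow> 'a) \<Rightarrow> (real \<Rightarrow> 'a) \<Rightarrow> (real \<Rightarrow> 'a)
      \<Rightarrow> (real \<Rightarrow> 'a) \<Rightarrow> (real \<Rightarrow> 'a) \<Rightarrow> bool" where
  "minimal_maximal_mild_solutions \<omega> \<tau> T F v\<^sub>0 w\<^sub>0 u_min u_max \<longleftrightarrow>
     mild_solution \<omega> \<tau> T F u_min \<and> mild_solution \<omega> \<tau> T F u_max \<and>
     v\<^sub>0 \<le> u_min \<and> u_min \<le> u_max \<and> u_max \<le> w\<^sub>0 \<and>
     (\<forall>u. mild_solution \<omega> \<tau> T F u \<and> v\<^sub>0 \<le> u \<and> u \<le> w\<^sub>0 \<longrightarrow> u_min \<le> u \<and> u \<le> u_max)"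

definition one_sided_bound ::
    "real \<Rightarrow> (real \<times> 'a \<times> 'a \<Rightarrow> 'a::{banach, ordered_real_vector})
      \<Rightarrow> (real \<Rightarrow> 'a) \<Rightarrow> (real \<Rightarrow> 'a) \<Rightarrow> real \<Rightarrow> bool" where
  "one_sided_bound \<tau> F v\<^sub>0 w\<^sub>0 C \<longleftrightarrow>
     (\<forall>t x\<^sub>1 x\<^sub>2 y\<^sub>1 y\<^sub>2.
        v\<^sub>0 t \<le> x\<^sub>1 \<and> x\<^sub>1 \<le> x\<^sub>2 \<and> x\<^sub>2 \<le> w\<^sub>0 t \<and>
        v\<^sub>0 (t - \<tau>) \<le> y\<^sub>1 \<and> y\<^sub>1 \<le> y\<^sub>2 \<and> y\<^sub>2 \<le> w\<^sub>0 (t - \<tau>) \<longrightarrow>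
        F (t, x\<^sub>2, y\<^sub>2) - F (t, x\<^sub>1, y\<^sub>1) \<ge> - (C *\<^sub>R (x\<^sub>2 - x\<^sub>1)))"

definition shifted_semigroup ::
    "real \<Rightarrow> (real \<Rightarrow> 'a::real_normed_vector \<Rightarrow>\<^sub>L 'a) \<Rightarrow> real \<Rightarrow> 'a \<Rightarrow>\<^sub>L 'a" where
  "shifted_semigroup C T t = exp (- C * t) *\<^sub>R T t"

text \<open>The operator \<open>Q\<close> is only used for \<open>C\<close> above the growth exponent of \<open>T\<close> and \<open>\<omega> > 0\<close>.
  Then \<open>S(\<omega>)\<close> has spectral radius less than \<open>1\<close>, so \<open>I - S(\<omega>)\<close> is a bijection and \<^const>\<open>inv\<close>
  is its genuine inverse.\<close>

definition Q_op ::
    "real \<Rightarrow> real \<Rightarrow> (real \<Rightarrow> 'a::banach \<Rightarrow>\<^sub>L 'a) \<Rightarrow> (real \<times> 'a \<times> 'a \<Rightarrow> 'a) \<Rightarrow> real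
      \<Rightarrow> (real \<Rightarrow> 'a) \<Rightarrow> real \<Rightarrow> 'a" where
  "Q_op \<omega> \<tau> T F C u t =
     (let S = shifted_semigroup C T in
        inv (blinfun_apply (id_blinfun - S \<omega>))
          (integral {t - \<omega>..t} (\<lambda>s. S (t - s) (F (s, u s, u (s - \<tau>)) + C *\<^sub>R u s))))"

end

theory Submission
  imports Defs "HOL-Library.Periodic_Fun"
begin

text \<open>
  Passing to \<open>S(t) = e\<^bsup>-Ct\<^esup> T(t)\<close> turns mild solutions for \<open>T\<close> and \<open>F\<close> into mild solutions for \<open>S\<close> and
  \<open>G u = F(\<cdot>, u, u(\<cdot> - \<tau>)) + C u\<close>, and \<open>G\<close> is increasing on the order interval \<open>[v\<^sub>0, w\<^sub>0]\<close>. As \<open>S\<close> decays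
  exponentially, the linear problem with a periodic right-hand side has exactly one periodic mild
  solution, which depends monotonically on that side; so \<open>Q\<close> is increasing, its fixed points are the
  periodic mild solutions, and \<open>v\<^sub>0 \<le> Q v\<^sub>0\<close>, \<open>Q w\<^sub>0 \<le> w\<^sub>0\<close>.
  The iterates are monotone and order bounded. Normality makes the increments of such a sequence weakly
  unconditionally summable, hence the sequence weakly convergent by weak sequential completeness, and
  since convex sets have the same weak and norm closure, it converges in norm. Norm continuity of
  \<open>S(t)\<close> for \<open>t > 0\<close> makes the iterates equicontinuous, so the pointwise limits are uniform and one can
  pass to the limit under the integral.
\<close>

subsection \<open>Separation of points from convex sets\<close>

text \<open>The extremal solutions must not depend on \<open>C\<close>, whereas \<open>Q\<close>
  does. They are characterised by mild solutions for \<open>T\<close> alone, constructed for one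
  \<open>C\<close>, and recognised as the limits for every other admissible \<open>C\<close> by
  uniqueness. That an admissible \<open>C\<close> exists rests on the exponential bound for
  \<open>T\<close>, which follows from strong continuity at 0 by uniform boundedness. The inequality
  \<open>v\<^sub>0 \<le> Q v\<^sub>0\<close> is a comparison of right-hand sides: a lower solution
  is a mild solution for its own residual, the derivative plus \<open>A v\<^sub>0\<close>, so after
  the shift it is itself the periodic solution for a function below \<open>G v\<^sub>0\<close>. The
  inverse of \<open>I - S \<omega>\<close> preserves order because it is a Neumann series of
  positive operators. The obstacle is infinite dimension: bounded sets need not be relatively
  compact and \<open>F\<close> is merely continuous, so it need not be uniformly continuous on them.
  Compactness is used only for the graph of the limit over a bounded time interval, and
  \<open>F\<close> is controlled near that graph.\<close>

definition sublinear :: "('a::real_vector \<Rightarrow> real) \<Rightarrow> bool" where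
  "sublinear p \<longleftrightarrow> (\<forall>x y. p (x + y) \<le> p x + p y) \<and> (\<forall>c\<ge>0. \<forall>x. p (c *\<^sub>R x) = c * p x)"

text \<open>The scaling inequality for \<open>inverse c\<close> at the point
  \<open>c *\<^sub>R x\<close> is the reverse inequality for \<open>c\<close>, so for functionals
  defined as infima only one direction has to be checked.\<close>

lemma sublinearI:
  assumes "\<And>x y. p (x + y) \<le> p x + p y" and "p 0 = 0" and "\<And>c x. c > 0 \<Longrightarrow> p (c *\<^sub>R x) \<le> c * p x"
  shows "sublinear p"
proof -
  have "c * p x \<le> p (c *\<^sub>R x)" if "c > 0" for c x
  proof -
    have "p (inverse c *\<^sub>R (c *\<^sub>R x)) \<le> inverse c * p (c *\<^sub>R x)"
      using that by (intro assms) auto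
    then show ?thesis using that by (simp add: field_simps)
  qed
  with assms have "p (c *\<^sub>R x) = c * p x" if "c \<ge> 0" for c x
    using that by (cases "c = 0") (auto intro!: antisym)
  with assms(1) show ?thesis by (simp add: sublinear_def)
qed

lemma sublinear_add: "sublinear p \<Longrightarrow> p (x + y) \<le> p x + p y"
  and sublinear_scaleR: "sublinear p \<Longrightarrow> c \<ge> 0 \<Longrightarrow> p (c *\<^sub>R x) = c * p x"
  by (auto simp: sublinear_def)

lemma sublinear_0: "sublinear p \<Longrightarrow> p 0 = 0"
  using sublinear_scaleR[of p 0 0] by simp

lemma sublinear_ge_minus: "sublinear p \<Longrightarrow> - p (- x) \<le> p x"
  using sublinear_add[of p x "- x"] by (simp add: sublinear_0)

text \<open>Near-optimal choices \<open>q\<close> for \<open>x\<close> and \<open>r\<close> for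
  \<open>y\<close> may differ; in a chain the smaller of the two serves both points, which saves
  subadditivity.\<close>

lemma sublinear_INF_chain:
  fixes Q :: "('a::real_vector \<Rightarrow> real) set"
  assumes "Q \<noteq> {}" and sub: "\<And>q. q \<in> Q \<Longrightarrow> sublinear q"
    and chain: "\<And>q r. q \<in> Q \<Longrightarrow> r \<in> Q \<Longrightarrow> q \<le> r \<or> r \<le> q"
    and bdd: "\<And>x. bdd_below ((\<lambda>q. q x) ` Q)"
  shows "sublinear (\<lambda>x. INF q\<in>Q. q x)"
proof (rule sublinearI)
  fix x y
  have "(INF q\<in>Q. q (x + y)) \<le> q x + r y" if "q \<in> Q" "r \<in> Q" for q r
  proof -
    from chain[OF that] have "\<exists>s\<in>Q. s \<le> q \<and> s \<le> r"
      using that by (elim disjE) auto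
    then obtain s where s: "s \<in> Q" "s \<le> q" "s \<le> r" by auto
    have "(INF q\<in>Q. q (x + y)) \<le> s (x + y)" by (rule cINF_lower[OF bdd s(1)])
    also have "\<dots> \<le> s x + s y" by (rule sublinear_add[OF sub[OF s(1)]])
    also have "\<dots> \<le> q x + r y" using le_funD[OF s(2), of x] le_funD[OF s(3), of y] by simp
    finally show ?thesis .
  qed
  then have "(INF q\<in>Q. q (x + y)) - q x \<le> r y" if "q \<in> Q" "r \<in> Q" for q r
    using that by (simp only: diff_le_eq add.commute)
  then have "(INF q\<in>Q. q (x + y)) - q x \<le> (INF r\<in>Q. r y)" if "q \<in> Q" for q
    using that by (intro cINF_greatest \<open>Q \<noteq> {}\<close>)
  then have "(INF q\<in>Q. q (x + y)) - (INF r\<in>Q. r y) \<le> q x" if "q \<in> Q" for q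
    using that by (simp only: diff_le_eq add.commute)
  then have "(INF q\<in>Q. q (x + y)) - (INF r\<in>Q. r y) \<le> (INF q\<in>Q. q x)"
    by (intro cINF_greatest \<open>Q \<noteq> {}\<close>)
  then show "(INF q\<in>Q. q (x + y)) \<le> (INF q\<in>Q. q x) + (INF q\<in>Q. q y)" by simp
next
  have "(INF q\<in>Q. q 0) = (INF q\<in>Q. 0::real)" by (intro INF_cong refl sublinear_0 sub)
  with \<open>Q \<noteq> {}\<close> show "(INF q\<in>Q. q 0) = 0" by simp
next
  fix c :: real and x assume "c > 0"
  have "(INF q\<in>Q. q (c *\<^sub>R x)) / c \<le> (INF q\<in>Q. q x)"
  proof (rule cINF_greatest[OF \<open>Q \<noteq> {}\<close>])
    fix q assume "q \<in> Q"
    have "(INF q\<in>Q. q (c *\<^sub>R x)) \<le> q (c *\<^sub>R x)" by (rule cINF_lower[OF bdd \<open>q \<in> Q\<close>])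
    then show "(INF q\<in>Q. q (c *\<^sub>R x)) / c \<le> q x"
      using \<open>c > 0\<close> sublinear_scaleR[OF sub[OF \<open>q \<in> Q\<close>]] by (simp add: field_simps)
  qed
  then show "(INF q\<in>Q. q (c *\<^sub>R x)) \<le> c * (INF q\<in>Q. q x)" using \<open>c > 0\<close> by (simp add: field_simps)
qed

text \<open>The modification of \<open>q\<close> along \<open>y\<close> lies below \<open>q\<close>, so a minimal sublinear functional
  equals all its modifications, which makes it superadditive.\<close>

lemma minimal_sublinear_linear:
  assumes q: "sublinear q" and min: "\<And>r. sublinear r \<Longrightarrow> r \<le> q \<Longrightarrow> r = q"
  shows "linear q"
proof -
  have superadd: "q x + q y \<le> q (x + y)" for x y
  proof -
    define g where "g x t = q (x + t *\<^sub>R y) - t * q y" for x t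
    define r where "r x = (INF t\<in>{0..}. g x t)" for x
    \<comment> \<open>Without this bound, uniform in \<open>t\<close>, the infimum
      \<open>r x\<close> would be a meaningless default value.\<close>
    have lb: "- q (- x) \<le> g x t" if "t \<ge> 0" for x t
    proof -
      have "t * q y = q ((x + t *\<^sub>R y) + (- x))" using that q by (simp add: sublinear_scaleR)
      also have "\<dots> \<le> q (x + t *\<^sub>R y) + q (- x)" by (rule sublinear_add[OF q])
      finally show ?thesis by (simp add: g_def)
    qed
    have bdd: "bdd_below (g x ` {0..})" for x using lb[of _ x] by (intro bdd_belowI[of _ "- q (- x)"]) auto
    have r_le: "r x \<le> g x t" if "t \<ge> 0" for x t
      unfolding r_def using that by (intro cINF_lower bdd) auto
    have "sublinear r"
    proof (rule sublinearI)
      fix x z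
      have "r (x + z) \<le> g x s + g z t" if "s \<ge> 0" "t \<ge> 0" for s t
      proof -
        have "r (x + z) \<le> g (x + z) (s + t)" using that by (intro r_le) auto
        also have "\<dots> = q ((x + s *\<^sub>R y) + (z + t *\<^sub>R y)) - (s + t) * q y"
          by (simp add: g_def algebra_simps)
        also have "\<dots> \<le> g x s + g z t"
          using sublinear_add[OF q, of "x + s *\<^sub>R y" "z + t *\<^sub>R y"] by (simp add: g_def algebra_simps)
        finally show ?thesis .
      qed
      then have "r (x + z) - g x s \<le> r z" if "s \<ge> 0" for s
        unfolding r_def[of z] using that by (intro cINF_greatest) (auto simp: algebra_simps)
      then have "r (x + z) - r z \<le> r x"
        unfolding r_def[of x] by (intro cINF_greatest) (auto simp: algebra_simps)
      then show "r (x + z) \<le> r x + r z" by simp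
    next
      have "r 0 \<le> 0" using r_le[of 0 0] q by (simp add: g_def sublinear_0)
      moreover have "0 \<le> r 0" unfolding r_def
        using lb[of _ 0] q by (intro cINF_greatest) (auto simp: sublinear_0)
      ultimately show "r 0 = 0" by simp
    next
      fix c :: real and x assume c: "c > 0"
      have "r (c *\<^sub>R x) / c \<le> r x" unfolding r_def[of x]
      proof (rule cINF_greatest)
        fix t :: real assume "t \<in> {0..}"
        have "r (c *\<^sub>R x) \<le> g (c *\<^sub>R x) (c * t)" using c \<open>t \<in> {0..}\<close> by (intro r_le) auto
        also have "\<dots> = q (c *\<^sub>R (x + t *\<^sub>R y)) - c * (t * q y)" by (simp add: g_def algebra_simps)
        also have "q (c *\<^sub>R (x + t *\<^sub>R y)) = c * q (x + t *\<^sub>R y)"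
          using c by (intro sublinear_scaleR[OF q]) auto
        also have "c * q (x + t *\<^sub>R y) - c * (t * q y) = c * g x t" by (simp add: g_def algebra_simps)
        finally show "r (c *\<^sub>R x) / c \<le> g x t" using c by (simp add: field_simps)
      qed auto
      then show "r (c *\<^sub>R x) \<le> c * r x" using c by (simp add: field_simps)
    qed
    moreover have "r \<le> q" using r_le[of 0] by (auto simp: le_fun_def g_def)
    ultimately have "r = q" by (rule min)
    \<comment> \<open>With \<open>r = q\<close>, the parameter \<open>t = 1\<close> reads
      \<open>q x \<le> q (x + y) - q y\<close>.\<close>
    then show ?thesis using r_le[of 1 x] by (simp add: g_def)
  qed
  have add: "q (x + y) = q x + q y" for x y
    using superadd[of x y] sublinear_add[OF q, of x y] by simp
  have neg: "q (- x) = - q x" for x using add[of x "- x"] q by (simp add: sublinear_0)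
  have "q (c *\<^sub>R x) = c * q x" for c x
  proof (cases "c \<ge> 0")
    case False
    then have "q ((- c) *\<^sub>R x) = (- c) * q x" by (intro sublinear_scaleR[OF q]) auto
    then show ?thesis using neg[of "c *\<^sub>R x"] by simp
  qed (simp add: q sublinear_scaleR)
  with add show ?thesis by (intro linearI) auto
qed

text \<open>Nothing is extended from a subspace: Zorn's lemma, with the order reversed, is applied
  to the sublinear functionals below \<open>p\<close>, and a minimal one is linear on the whole
  space.\<close>

theorem hahn_banach_sublinear:
  assumes p: "sublinear p"
  shows "\<exists>f. linear f \<and> (\<forall>x. f x \<le> p x)"
proof -
  define A where "A = {q. sublinear q \<and> q \<le> p}"
  have po: "partial_order_on A (relation_of (\<lambda>q r. r \<le> q) A)"
    by (auto simp: relation_of_def partial_order_on_def preorder_on_def refl_on_def trans_def antisym_def)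
  have "\<exists>m\<in>A. \<forall>q\<in>A. q \<le> m \<longrightarrow> q = m"
  proof (rule predicate_Zorn[OF po])
    fix Q assume Q: "Q \<in> Chains (relation_of (\<lambda>q r. r \<le> q) A)"
    show "\<exists>u\<in>A. \<forall>q\<in>Q. u \<le> q"
    proof (cases "Q = {}")
      case True
      with p show ?thesis by (auto simp: A_def)
    next
      case False
      have QA: "q \<in> A" if "q \<in> Q" for q using Q that by (auto simp: Chains_def relation_of_def)
      have chain: "q \<le> r \<or> r \<le> q" if "q \<in> Q" "r \<in> Q" for q r
        using Q that by (auto simp: Chains_def relation_of_def)
      \<comment> \<open>A lower bound independent of \<open>q\<close>, so that the pointwise infimum
        over the chain is finite.\<close>
      have "- p (- x) \<le> q x" if "q \<in> Q" for q x
      proof -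
        have "- p (- x) \<le> - q (- x)" using QA[OF that] by (auto simp: A_def le_fun_def)
        also have "\<dots> \<le> q x" using QA[OF that] by (intro sublinear_ge_minus) (simp add: A_def)
        finally show ?thesis .
      qed
      then have bdd: "bdd_below ((\<lambda>q. q x) ` Q)" for x by (intro bdd_belowI[of _ "- p (- x)"]) auto
      have low: "(\<lambda>x. INF q\<in>Q. q x) \<le> q" if "q \<in> Q" for q
        using that by (auto simp: le_fun_def intro!: cINF_lower bdd)
      obtain q where q: "q \<in> Q" using False by auto
      have "(\<lambda>x. INF q\<in>Q. q x) \<le> p" using low[OF q] QA[OF q] by (auto simp: A_def)
      moreover have "sublinear (\<lambda>x. INF q\<in>Q. q x)"
        using QA by (intro sublinear_INF_chain False chain bdd) (auto simp: A_def)
      ultimately have "(\<lambda>x. INF q\<in>Q. q x) \<in> A" by (simp add: A_def)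
      with low show ?thesis by blast
    qed
  qed
  then obtain m where m: "m \<in> A" and "\<And>q. q \<in> A \<Longrightarrow> q \<le> m \<Longrightarrow> q = m" by auto
  then have "linear m" by (intro minimal_sublinear_linear) (auto simp: A_def)
  with m show ?thesis by (auto simp: A_def le_fun_def)
qed

text \<open>The functional is obtained below \<open>p z = inf (norm (z + t (l - c)) - t \<delta>)\<close> over \<open>t \<ge> 0\<close> and \<open>c \<in> S\<close>:
  this \<open>p\<close> is at most the norm, and \<open>p (c - l) \<le> - \<delta>\<close>.\<close>

lemma separate_point_convex:
  fixes S :: "'a::real_normed_vector set"
  assumes "convex S" and "S \<noteq> {}" and "\<delta> > 0" and far: "\<And>c. c \<in> S \<Longrightarrow> \<delta> \<le> norm (l - c)"
  shows "\<exists>f::'a \<Rightarrow>\<^sub>L real. \<forall>c\<in>S. \<delta> \<le> f (l - c)"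
proof -
  define g where "g z t c = norm (z + t *\<^sub>R (l - c)) - t * \<delta>" for z t c
  define I where "I = {0::real..} \<times> S"
  define p where "p z = (INF i\<in>I. g z (fst i) (snd i))" for z
  have ne: "I \<noteq> {}" using \<open>S \<noteq> {}\<close> by (auto simp: I_def)
  have lb: "- norm z \<le> g z t c" if "t \<ge> 0" "c \<in> S" for z t c
  proof -
    have "t * \<delta> \<le> norm (t *\<^sub>R (l - c))" using far[OF that(2)] that(1) by (simp add: mult_left_mono)
    also have "\<dots> \<le> norm (z + t *\<^sub>R (l - c)) + norm z"
      using norm_triangle_ineq4[of "z + t *\<^sub>R (l - c)" z] by simp
    finally show ?thesis by (simp add: g_def)
  qed
  have bdd: "bdd_below ((\<lambda>i. g z (fst i) (snd i)) ` I)" for z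
    using lb[of _ _ z] by (intro bdd_belowI[of _ "- norm z"]) (auto simp: I_def)
  have p_le: "p z \<le> g z t c" if "t \<ge> 0" "c \<in> S" for z t c
    unfolding p_def using cINF_lower[OF bdd, of "(t, c)" z] that by (auto simp: I_def)
  have p_ge: "a \<le> p z" if "\<And>t c. t \<ge> 0 \<Longrightarrow> c \<in> S \<Longrightarrow> a \<le> g z t c" for a z
    unfolding p_def using that ne by (intro cINF_greatest) (auto simp: I_def)
  obtain c0 where c0: "c0 \<in> S" using \<open>S \<noteq> {}\<close> by auto
  have p_norm: "p z \<le> norm z" for z using p_le[of 0 c0 z] c0 by (simp add: g_def)
  have "sublinear p"
  proof (rule sublinearI)
    fix x y
    have "p (x + y) \<le> g x s c + g y t d" if "s \<ge> 0" "t \<ge> 0" "c \<in> S" "d \<in> S" for s t c d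
    proof (cases "s + t = 0")
      case True
      then have "s = 0" "t = 0" using that by auto
      then show ?thesis using p_norm[of "x + y"] norm_triangle_ineq[of x y] by (simp add: g_def)
    next
      case False
      \<comment> \<open>The weights are chosen so that the displacements towards \<open>c\<close>
        and \<open>d\<close> add up to a single one with parameter \<open>s + t\<close>; this is
        where convexity enters.\<close>
      define e where "e = (s / (s + t)) *\<^sub>R c + (t / (s + t)) *\<^sub>R d"
      have "e \<in> S" unfolding e_def using that False \<open>convex S\<close>
        by (intro convexD) (auto simp: add_divide_distrib[symmetric])
      have "(s + t) *\<^sub>R e = s *\<^sub>R c + t *\<^sub>R d" using False by (simp add: e_def scaleR_add_right)
      then have eq: "x + y + (s + t) *\<^sub>R (l - e) = (x + s *\<^sub>R (l - c)) + (y + t *\<^sub>R (l - d))"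
        by (simp add: scaleR_diff_right scaleR_add_left)
      have "p (x + y) \<le> g (x + y) (s + t) e" using that \<open>e \<in> S\<close> by (intro p_le) auto
      also have "\<dots> \<le> g x s c + g y t d"
        unfolding g_def eq using norm_triangle_ineq[of "x + s *\<^sub>R (l - c)" "y + t *\<^sub>R (l - d)"]
        by (simp add: algebra_simps)
      finally show ?thesis .
    qed
    then have "p (x + y) - g x s c \<le> p y" if "s \<ge> 0" "c \<in> S" for s c
      using that by (intro p_ge) (auto simp: algebra_simps)
    then have "p (x + y) - p y \<le> p x" by (intro p_ge) (auto simp: algebra_simps)
    then show "p (x + y) \<le> p x + p y" by simp
  next
    have "0 \<le> p 0" using lb[of _ _ 0] by (intro p_ge) auto
    with p_norm[of 0] show "p 0 = 0" by simp
  next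
    fix k :: real and x assume k: "k > 0"
    have "p (k *\<^sub>R x) / k \<le> p x"
    proof (rule p_ge)
      fix t :: real and c assume tc: "t \<ge> 0" "c \<in> S"
      have "k *\<^sub>R x + (k * t) *\<^sub>R (l - c) = k *\<^sub>R (x + t *\<^sub>R (l - c))" by (simp add: scaleR_add_right)
      then have "g (k *\<^sub>R x) (k * t) c = norm (k *\<^sub>R (x + t *\<^sub>R (l - c))) - k * t * \<delta>" by (simp only: g_def)
      also have "\<dots> = k * g x t c" using k by (simp only: norm_scaleR g_def) (simp add: algebra_simps)
      finally have "g (k *\<^sub>R x) (k * t) c = k * g x t c" .
      moreover have "p (k *\<^sub>R x) \<le> g (k *\<^sub>R x) (k * t) c" using k tc by (intro p_le) auto
      ultimately show "p (k *\<^sub>R x) / k \<le> g x t c" using k by (simp add: field_simps)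
    qed
    then show "p (k *\<^sub>R x) \<le> k * p x" using k by (simp add: field_simps)
  qed
  from hahn_banach_sublinear[OF this] obtain f where "linear f" and f: "\<And>x. f x \<le> p x" by auto
  have "\<bar>f x\<bar> \<le> norm x" for x
    using order_trans[OF f p_norm, of x] order_trans[OF f p_norm, of "- x"] linear_neg[OF \<open>linear f\<close>, of x]
    by (simp add: abs_le_iff)
  then have "bounded_linear f"
    using \<open>linear f\<close> by (auto simp: bounded_linear_def bounded_linear_axioms_def intro!: exI[of _ 1])
  have "\<delta> \<le> f (l - c)" if "c \<in> S" for c
  proof -
    \<comment> \<open>At \<open>z = c - l\<close> and \<open>t = 1\<close> the norm in
      \<open>g\<close> vanishes and only \<open>- \<delta>\<close> remains.\<close>
    have "f (- (l - c)) \<le> g (- (l - c)) 1 c" using f p_le[of 1 c] that by (meson order_trans zero_le_one)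
    then show ?thesis using linear_neg[OF \<open>linear f\<close>, of "l - c"] by (simp add: g_def)
  qed
  then show ?thesis using \<open>bounded_linear f\<close> by (intro exI[of _ "Blinfun f"]) (simp add: bounded_linear_Blinfun_apply)
qed

text \<open>Mazur's theorem for sequences: at a positive distance \<open>\<delta>\<close> from
  \<open>S\<close>, a separating functional would keep \<open>f l - f (x n)\<close> above
  \<open>\<delta>\<close>, against weak convergence.\<close>

lemma weak_limit_in_closure_convex:
  fixes S :: "'a::real_normed_vector set"
  assumes "convex S" and ev: "eventually (\<lambda>n. x n \<in> S) sequentially"
    and weak: "\<And>f::'a \<Rightarrow>\<^sub>L real. (\<lambda>n. f (x n)) \<longlonglongrightarrow> f l"
  shows "l \<in> closure S"
proof (rule ccontr)
  assume "l \<notin> closure S"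
  then obtain \<delta> where "\<delta> > 0" and far: "\<And>c. c \<in> S \<Longrightarrow> \<delta> \<le> norm (l - c)"
    by (auto simp: closure_approachable dist_norm norm_minus_commute[of _ l] not_less)
  have "S \<noteq> {}" using eventually_happens'[OF sequentially_bot ev] by auto
  then obtain f :: "'a \<Rightarrow>\<^sub>L real" where f: "\<And>c. c \<in> S \<Longrightarrow> \<delta> \<le> f (l - c)"
    using separate_point_convex[OF \<open>convex S\<close> \<open>S \<noteq> {}\<close> \<open>\<delta> > 0\<close> far] by blast
  have "(\<lambda>n. f l - f (x n)) \<longlonglongrightarrow> f l - f l" by (intro tendsto_intros weak)
  moreover have "eventually (\<lambda>n. \<delta> \<le> f l - f (x n)) sequentially"
    using ev by eventually_elim (use f in \<open>auto simp: blinfun.diff_right\<close>)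
  ultimately have "\<delta> \<le> f l - f l" by (intro tendsto_lowerbound) auto
  with \<open>\<delta> > 0\<close> show False by simp
qed

subsection \<open>Monotone sequences and integrals in ordered Banach spaces\<close>

text \<open>Splitting the indices by the sign of \<open>f (d k)\<close> turns the absolute sum into
  a difference of two values of \<open>f\<close> at subset sums. Each subset sum lies between 0 and
  \<open>y\<close>, so normality bounds it regardless of the subset.\<close>

lemma summable_functional_increments:
  fixes d :: "nat \<Rightarrow> 'a::{real_normed_vector, ordered_real_vector}" and f :: "'a \<Rightarrow>\<^sub>L real"
  assumes normal: "\<And>x y::'a. 0 \<le> x \<Longrightarrow> x \<le> y \<Longrightarrow> norm x \<le> N * norm y"
    and "\<And>k. 0 \<le> d k" and bound: "\<And>n. (\<Sum>k<n. d k) \<le> y"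
  shows "summable (\<lambda>k. \<bar>f (d k)\<bar>)"
proof (rule summableI_nonneg_bounded)
  fix n
  have part: "\<bar>f (sum d P)\<bar> \<le> norm f * (N * norm y)" if "P \<subseteq> {..<n}" for P
  proof -
    have "sum d P \<le> (\<Sum>k<n. d k)" using that assms(2) by (intro sum_mono2) auto
    then have "norm (sum d P) \<le> N * norm y"
      using assms(2) bound[of n] by (intro normal sum_nonneg) auto
    then have "norm f * norm (sum d P) \<le> norm f * (N * norm y)" by (intro mult_left_mono) auto
    then show ?thesis using norm_blinfun[of f "sum d P"] by simp
  qed
  define P where "P = {k\<in>{..<n}. 0 \<le> f (d k)}"
  have "(\<Sum>k<n. \<bar>f (d k)\<bar>) = (\<Sum>k\<in>P. \<bar>f (d k)\<bar>) + (\<Sum>k\<in>{..<n} - P. \<bar>f (d k)\<bar>)"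
    by (intro sum.subset_diff[THEN trans, OF _ _ add.commute]) (auto simp: P_def)
  also have "\<dots> = f (sum d P) - f (sum d ({..<n} - P))"
    by (simp add: blinfun.sum_right P_def sum_negf[symmetric] del: sum_negf)
       (auto intro!: arg_cong2[where f = minus] arg_cong2[where f = plus] sum.cong)
  also have "\<dots> \<le> 2 * (norm f * (N * norm y))"
    using part[of P] part[of "{..<n} - P"] by (fastforce simp: P_def abs_le_iff)
  finally show "(\<Sum>k<n. \<bar>f (d k)\<bar>) \<le> 2 * (norm f * (N * norm y))" .
qed simp

text \<open>The functional need not be positive, so \<open>f (x n)\<close> need not be monotone;
  absolutely summable increments take the place of monotone convergence of reals.\<close>

lemma monotone_functional_Cauchy:
  fixes x :: "nat \<Rightarrow> 'a::{real_normed_vector, ordered_real_vector}" and f :: "'a \<Rightarrow>\<^sub>L real"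
  assumes normal: "\<And>x y::'a. 0 \<le> x \<Longrightarrow> x \<le> y \<Longrightarrow> norm x \<le> N * norm y"
    and "incseq x" and "\<And>n. x n \<le> y"
  shows "Cauchy (\<lambda>n. f (x n))"
proof -
  define d where "d k = x (Suc k) - x k" for k
  have sum_d: "(\<Sum>k<n. d k) = x n - x 0" for n by (simp add: d_def sum_lessThan_telescope)
  have "summable (\<lambda>k. \<bar>f (d k)\<bar>)"
  proof (rule summable_functional_increments[OF normal])
    show "0 \<le> d k" for k using incseq_SucD[OF \<open>incseq x\<close>] by (simp add: d_def)
    show "(\<Sum>k<n. d k) \<le> y - x 0" for n using assms(3) by (simp add: sum_d)
  qed
  then have "summable (\<lambda>k. f (d k))" by (rule summable_rabs_cancel)
  then have "convergent (\<lambda>n. \<Sum>k<n. f (d k))" by (simp add: summable_iff_convergent)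
  then have "convergent (\<lambda>n. f (x 0) + f (x n - x 0))"
    by (intro convergent_add convergent_const) (simp add: blinfun.sum_right[symmetric] sum_d)
  then show ?thesis by (simp add: blinfun.diff_right Cauchy_convergent_iff)
qed

text \<open>The weak limit \<open>l\<close> dominates every \<open>x m\<close>, since the points
  above \<open>x m\<close> form a closed convex set. It is also a norm limit of points lying below
  some iterate, and normality then squeezes the tail of the sequence towards
  \<open>l\<close>.\<close>

theorem monotone_bounded_convergent:
  fixes x :: "nat \<Rightarrow> 'a::{banach, ordered_real_vector}"
  assumes cone: "closed {u::'a. 0 \<le> u}"
    and normal: "\<And>x y::'a. 0 \<le> x \<Longrightarrow> x \<le> y \<Longrightarrow> norm x \<le> N * norm y" and "N > 0"
    and wsc: "weakly_sequentially_complete (UNIV :: 'a set)"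
    and x: "incseq x" "\<And>n. x n \<le> y"
  shows "convergent x"
proof -
  obtain l where l: "\<And>f :: 'a \<Rightarrow>\<^sub>L real. (\<lambda>n. f (x n)) \<longlonglongrightarrow> f l"
    using wsc monotone_functional_Cauchy[OF normal x] unfolding weakly_sequentially_complete_def by blast
  have below: "x m \<le> l" for m
  proof -
    have "convex {c. x m \<le> c}"
    proof (rule convexI)
      fix a b u v assume "a \<in> {c. x m \<le> c}" "b \<in> {c. x m \<le> c}" and uv: "0 \<le> u" "0 \<le> v" "u + v = (1::real)"
      then have "u *\<^sub>R x m + v *\<^sub>R x m \<le> u *\<^sub>R a + v *\<^sub>R b"
        by (intro add_mono scaleR_left_mono) auto
      then show "u *\<^sub>R a + v *\<^sub>R b \<in> {c. x m \<le> c}" using uv by (simp add: scaleR_add_left[symmetric])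
    qed
    moreover have "eventually (\<lambda>n. x n \<in> {c. x m \<le> c}) sequentially"
      using eventually_ge_at_top[of m] by eventually_elim (use \<open>incseq x\<close> in \<open>auto simp: incseq_def\<close>)
    ultimately have "l \<in> closure {c. x m \<le> c}" using l by (rule weak_limit_in_closure_convex)
    moreover have "closed {c. x m \<le> c}"
      using closed_vimage[OF cone, of "\<lambda>c. c - x m"] by (simp add: vimage_def continuous_intros)
    ultimately show ?thesis by simp
  qed
  \<comment> \<open>Unlike a convex combination handled as such, a point \<open>c\<close> of this
    set stays below all later \<open>x n\<close>, so that
    \<open>0 \<le> l - x n \<le> l - c\<close>. Monotonicity of the sequence makes the set
    convex.\<close>
  define S where "S = {c. \<exists>n. c \<le> x n}"
  have "convex S"
  proof (rule convexI)
    fix a b u v assume "a \<in> S" "b \<in> S" and uv: "0 \<le> u" "0 \<le> v" "u + v = (1::real)"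
    then obtain m n where "a \<le> x m" "b \<le> x n" by (auto simp: S_def)
    then have "a \<le> x (max m n)" "b \<le> x (max m n)"
      using incseqD[OF \<open>incseq x\<close>] by (meson max.cobounded1 max.cobounded2 order_trans)+
    then have "u *\<^sub>R a + v *\<^sub>R b \<le> u *\<^sub>R x (max m n) + v *\<^sub>R x (max m n)"
      using uv by (intro add_mono scaleR_left_mono) auto
    then show "u *\<^sub>R a + v *\<^sub>R b \<in> S" using uv by (auto simp: S_def scaleR_add_left[symmetric])
  qed
  have "l \<in> closure S"
    by (rule weak_limit_in_closure_convex[OF \<open>convex S\<close> _ l]) (auto simp: S_def intro!: always_eventually)
  have "x \<longlonglongrightarrow> l"
  proof (rule LIMSEQ_I)
    fix e :: real assume "e > 0"
    with \<open>N > 0\<close> have "e / N > 0" by simp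
    with \<open>l \<in> closure S\<close> obtain c where "c \<in> S" "dist c l < e / N"
      unfolding closure_approachable by blast
    then obtain m where m: "c \<le> x m" and c: "norm (l - c) < e / N"
      by (auto simp: S_def dist_norm norm_minus_commute[of c])
    have "norm (x n - l) < e" if "n \<ge> m" for n
    proof -
      have "c \<le> x n" using m incseqD[OF \<open>incseq x\<close> that] by (rule order_trans)
      then have "norm (l - x n) \<le> N * norm (l - c)" using below by (intro normal) auto
      also have "\<dots> < e" using c \<open>N > 0\<close> by (simp add: field_simps)
      finally show ?thesis by (simp add: norm_minus_commute)
    qed
    then show "\<exists>m. \<forall>n\<ge>m. norm (x n - l) < e" by blast
  qed
  then show ?thesis by (rule convergentI)
qed

section \<open>Order under limits and integrals, and uniform convergence near compact sets\<close>

lemma tendsto_le_cone: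
  fixes f g :: "'b \<Rightarrow> 'a::{real_normed_vector, ordered_real_vector}"
  assumes cone: "closed {u::'a. 0 \<le> u}" and "F \<noteq> bot" and "(f \<longlongrightarrow> a) F" "(g \<longlongrightarrow> b) F"
    and "eventually (\<lambda>x. f x \<le> g x) F"
  shows "a \<le> b"
proof -
  have "((\<lambda>x. g x - f x) \<longlongrightarrow> b - a) F" by (intro tendsto_diff assms)
  moreover have "eventually (\<lambda>x. g x - f x \<in> {u. 0 \<le> u}) F" using assms(5) by eventually_elim simp
  ultimately have "b - a \<in> {u. 0 \<le> u}" by (intro Lim_in_closed_set[OF cone _ \<open>F \<noteq> bot\<close>])
  then show ?thesis by simp
qed

text \<open>The integral is vector valued, so its sign is read off from the tagged Riemann sums of
  \<open>g - f\<close>: they lie in the cone and approximate the integral, and the cone is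
  closed.\<close>

lemma integral_mono_cone:
  fixes f g :: "real \<Rightarrow> 'a::{real_normed_vector, ordered_real_vector}"
  assumes cone: "closed {u::'a. 0 \<le> u}"
    and "f integrable_on {a..b}" "g integrable_on {a..b}" and "\<And>x. x \<in> {a..b} \<Longrightarrow> f x \<le> g x"
  shows "integral {a..b} f \<le> integral {a..b} g"
proof -
  define h where "h x = g x - f x" for x
  have int: "(h has_integral integral {a..b} g - integral {a..b} f) (cbox a b)"
    unfolding h_def using assms(2,3) by (auto intro!: has_integral_diff simp: has_integral_integral)
  have "integral {a..b} g - integral {a..b} f \<in> closure {u. 0 \<le> u}"
    unfolding closure_approachable
  proof (intro allI impI)
    fix e :: real assume "e > 0"
    from int[unfolded has_integral, rule_format, OF this] obtain \<gamma> where "gauge \<gamma>" and \<gamma>: "\<And>\<D>. \<D> tagged_division_of (cbox a b) \<and> \<gamma> fine \<D> \<Longrightarrow>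
        norm ((\<Sum>(x,k)\<in>\<D>. measure lborel k *\<^sub>R h x) - (integral {a..b} g - integral {a..b} f)) < e"
      by blast
    obtain \<D> where D: "\<D> tagged_division_of {a..b}" "\<gamma> fine \<D>"
      using fine_division_exists_real[OF \<open>gauge \<gamma>\<close>] by blast
    have "0 \<le> (\<Sum>(x,k)\<in>\<D>. measure lborel k *\<^sub>R h x)"
    proof (rule sum_nonneg)
      fix p assume "p \<in> \<D>"
      then obtain x k where "p = (x, k)" "(x, k) \<in> \<D>" by (cases p) auto
      moreover from this have "x \<in> {a..b}" using tagged_division_ofD(2,3)[OF D(1)] by blast
      ultimately show "0 \<le> (case p of (x, k) \<Rightarrow> measure lborel k *\<^sub>R h x)"
        using assms(4) by (auto simp: h_def intro!: scaleR_nonneg_nonneg)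
    qed
    moreover have "norm ((\<Sum>(x,k)\<in>\<D>. measure lborel k *\<^sub>R h x) - (integral {a..b} g - integral {a..b} f)) < e"
      using \<gamma>[of \<D>] D by simp
    ultimately show "\<exists>y\<in>{u. 0 \<le> u}. dist y (integral {a..b} g - integral {a..b} f) < e"
      unfolding dist_norm by blast
  qed
  then show ?thesis using closure_closed[OF cone] by simp
qed

text \<open>Iterates approach the compact range of their limit without lying in it, so
  \<open>y\<close> runs through the whole space. The radius \<open>d\<close> is a Lebesgue number
  for a cover of \<open>K\<close> by open sets on which \<open>F\<close> oscillates little.\<close>

lemma continuous_near_compact:
  fixes F :: "'a::metric_space \<Rightarrow> 'b::metric_space"
  assumes cont: "continuous_on UNIV F" and "compact K" and "e > 0"
  shows "\<exists>d>0. \<forall>k\<in>K. \<forall>y. dist y k < d \<longrightarrow> dist (F y) (F k) < e"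
proof -
  define \<G> where "\<G> = {G. open G \<and> (\<exists>x. \<forall>y\<in>G. dist (F y) (F x) < e / 2)}"
  have "x \<in> \<Union>\<G>" for x
  proof
    show "F -` ball (F x) (e / 2) \<in> \<G>"
      using open_vimage[OF open_ball cont] by (auto simp: \<G>_def dist_commute)
    show "x \<in> F -` ball (F x) (e / 2)" using \<open>e > 0\<close> by simp
  qed
  then have "K \<subseteq> \<Union>\<G>" by blast
  from Heine_Borel_lemma[OF \<open>compact K\<close> this] obtain d where "d > 0"
    and d: "\<And>x. x \<in> K \<Longrightarrow> \<exists>G\<in>\<G>. ball x d \<subseteq> G" by (auto simp: \<G>_def)
  have "dist (F y) (F k) < e" if "k \<in> K" "dist y k < d" for k y
  proof -
    obtain G where "G \<in> \<G>" "ball k d \<subseteq> G" using d[OF \<open>k \<in> K\<close>] by blast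
    moreover have "k \<in> ball k d" "y \<in> ball k d" using that \<open>d > 0\<close> by (auto simp: dist_commute)
    ultimately have "\<exists>x. dist (F k) (F x) < e / 2 \<and> dist (F y) (F x) < e / 2" unfolding \<G>_def by blast
    then obtain x where "dist (F k) (F x) < e / 2" "dist (F y) (F x) < e / 2" by blast
    then show ?thesis using dist_triangle_half_r[of "F x" "F y" e "F k"] by (simp add: dist_commute)
  qed
  with \<open>d > 0\<close> show ?thesis by blast
qed

lemma uniform_limit_compose_near_compact:
  fixes F :: "'a::metric_space \<Rightarrow> 'b::metric_space"
  assumes "continuous_on UNIV F" and "compact (l ` S)" and "uniform_limit S u l X"
  shows "uniform_limit S (\<lambda>i t. F (u i t)) (\<lambda>t. F (l t)) X"
proof (rule uniform_limitI)
  fix e :: real assume "e > 0"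
  then obtain d where "d > 0" and d: "\<And>t y. t \<in> S \<Longrightarrow> dist y (l t) < d \<Longrightarrow> dist (F y) (F (l t)) < e"
    using continuous_near_compact[OF assms(1,2)] by fastforce
  show "eventually (\<lambda>i. \<forall>t\<in>S. dist (F (u i t)) (F (l t)) < e) X"
    using uniform_limitD[OF assms(3) \<open>d > 0\<close>] by eventually_elim (use d in blast)
qed

text \<open>The part of the Arzela-Ascoli argument that remains when pointwise convergence is known:
  a finite net of \<open>S\<close> reduces uniform convergence to finitely many points.\<close>

lemma equicontinuous_pointwise_uniform_limit:
  fixes u :: "'i \<Rightarrow> 'a::metric_space \<Rightarrow> 'b::metric_space"
  assumes "X \<noteq> bot" and equi: "\<And>e. e > 0 \<Longrightarrow> \<exists>d>0. \<forall>i s t. dist s t < d \<longrightarrow> dist (u i s) (u i t) < e"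
    and lim: "\<And>t. ((\<lambda>i. u i t) \<longlongrightarrow> l t) X" and "compact S"
  shows "continuous_on UNIV l" and "uniform_limit S u l X"
proof -
  have l_equi: "\<exists>d>0. \<forall>s t. dist s t < d \<longrightarrow> dist (l s) (l t) \<le> e" if "e > 0" for e
  proof -
    obtain d where "d > 0" and d: "\<And>i s t. dist s t < d \<Longrightarrow> dist (u i s) (u i t) < e"
      using equi[OF \<open>e > 0\<close>] by blast
    have "dist (l s) (l t) \<le> e" if "dist s t < d" for s t
    proof (rule tendsto_upperbound)
      show "((\<lambda>i. dist (u i s) (u i t)) \<longlongrightarrow> dist (l s) (l t)) X" by (intro tendsto_dist lim)
      show "eventually (\<lambda>i. dist (u i s) (u i t) \<le> e) X"
        using d[OF that] by (intro always_eventually allI less_imp_le)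
    qed fact
    with \<open>d > 0\<close> show ?thesis by blast
  qed
  show "continuous_on UNIV l"
    unfolding continuous_on_iff
  proof (intro ballI allI impI)
    fix x and e :: real assume "e > 0"
    then obtain d where "d > 0" "\<forall>s t. dist s t < d \<longrightarrow> dist (l s) (l t) \<le> e / 2"
      using l_equi[of "e / 2"] by auto
    with \<open>e > 0\<close> show "\<exists>d>0. \<forall>x'\<in>UNIV. dist x' x < d \<longrightarrow> dist (l x') (l x) < e"
      by (intro exI[of _ d]) (auto intro: le_less_trans[of _ "e / 2"])
  qed
  show "uniform_limit S u l X"
  proof (rule uniform_limitI)
    fix e :: real assume "e > 0"
    then obtain d1 d2 where "d1 > 0" "d2 > 0"
      and d1: "\<And>i s t. dist s t < d1 \<Longrightarrow> dist (u i s) (u i t) < e / 3"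
      and d2: "\<And>s t. dist s t < d2 \<Longrightarrow> dist (l s) (l t) \<le> e / 3"
      using equi[of "e / 3"] l_equi[of "e / 3"] by (metis divide_pos_pos zero_less_numeral)
    define d where "d = min d1 d2"
    have "d > 0" using \<open>d1 > 0\<close> \<open>d2 > 0\<close> by (simp add: d_def)
    then obtain k where "finite k" and k: "S \<subseteq> (\<Union>x\<in>k. ball x d)"
      using compact_eq_totally_bounded[of S] \<open>compact S\<close> by blast
    have "eventually (\<lambda>i. \<forall>x\<in>k. dist (u i x) (l x) < e / 3) X"
      using \<open>finite k\<close> \<open>e > 0\<close> by (intro eventually_ball_finite ballI tendstoD[OF lim]) auto
    then show "eventually (\<lambda>i. \<forall>t\<in>S. dist (u i t) (l t) < e) X"
    proof eventually_elim
      fix i assume i: "\<forall>x\<in>k. dist (u i x) (l x) < e / 3"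
      show "\<forall>t\<in>S. dist (u i t) (l t) < e"
      proof
        fix t assume "t \<in> S"
        with k obtain x where "x \<in> k" "dist x t < d" by auto
        then have "dist (u i x) (u i t) < e / 3" "dist (l x) (l t) \<le> e / 3" "dist (u i x) (l x) < e / 3"
          using d1 d2 i by (auto simp: d_def)
        moreover have "dist (u i t) (l t) \<le> dist (u i x) (u i t) + dist (u i x) (l x) + dist (l x) (l t)"
          using dist_triangle[of "u i t" "l t" "u i x"] dist_triangle[of "u i x" "l t" "l x"]
          by (simp add: dist_commute)
        ultimately show "dist (u i t) (l t) < e" by linarith
      qed
    qed
  qed
qed

subsection \<open>Semigroups and mild solutions\<close>

text \<open>Since \<open>U w\<close> is half the difference of \<open>U (x + w)\<close> and
  \<open>U (x - w)\<close>, one of these two is at least as large as \<open>U w\<close>. The factor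
  \<open>2 / 3\<close> is below 1, so a suitable direction \<open>w\<close> exists, and above the
  \<open>1 / 2\<close> lost later in the gliding hump.\<close>

lemma blinfun_large_value_near:
  fixes U :: "'a::real_normed_vector \<Rightarrow>\<^sub>L 'b::real_normed_vector"
  assumes "r > 0"
  shows "\<exists>y. norm (y - x) \<le> r \<and> 2 / 3 * r * norm U \<le> norm (U y)"
proof (cases "norm U = 0")
  case False
  then obtain z where z: "z \<noteq> 0" "2 / 3 * norm U * norm z < norm (U z)"
  proof -
    have "\<not> (\<forall>z. norm (U z) \<le> 2 / 3 * norm U * norm z)"
      using False norm_blinfun_bound[of "2 / 3 * norm U" U] by auto
    then obtain z where "2 / 3 * norm U * norm z < norm (U z)" by (auto simp: not_le)
    moreover from this have "z \<noteq> 0" by (auto simp: blinfun.zero_right)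
    ultimately show ?thesis using that by auto
  qed
  define w where "w = (r / norm z) *\<^sub>R z"
  have nw: "norm w = r" using z assms by (simp add: w_def)
  have "2 / 3 * r * norm U = r / norm z * (2 / 3 * norm U * norm z)" using z by simp
  also have "\<dots> \<le> r / norm z * norm (U z)" using z assms by (intro mult_left_mono) auto
  also have "\<dots> = norm (U w)" using assms by (simp add: w_def blinfun.scaleR_right)
  finally have Uw: "2 / 3 * r * norm U \<le> norm (U w)" .
  have "2 * norm (U w) \<le> norm (U (x + w)) + norm (U (x - w))"
    using norm_triangle_ineq4[of "U (x + w)" "U (x - w)"]
    by (simp add: blinfun.add_right blinfun.diff_right scaleR_2[symmetric])
  then have "norm (U w) \<le> norm (U (x + w)) \<or> norm (U w) \<le> norm (U (x - w))" by linarith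
  then show ?thesis
  proof
    assume "norm (U w) \<le> norm (U (x + w))"
    with Uw nw show ?thesis by (intro exI[of _ "x + w"]) auto
  next
    assume "norm (U w) \<le> norm (U (x - w))"
    with Uw nw show ?thesis by (intro exI[of _ "x - w"]) auto
  qed
qed (use assms in \<open>auto intro!: exI[of _ x]\<close>)

text \<open>Gliding hump after Sokal: the \<open>n\<close>-th step moves the point by at most \<open>3\<^sup>-\<^sup>n\<close> and makes the value of
  \<open>U n\<close> large, and all later steps together are too short to undo this.\<close>

theorem uniform_boundedness:
  fixes U :: "nat \<Rightarrow> 'a::banach \<Rightarrow>\<^sub>L 'b::real_normed_vector"
  assumes large: "\<And>n. 4 ^ n \<le> norm (U n)"
  shows "\<exists>x. \<not> bounded (range (\<lambda>n. U n x))"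
proof -
  have "\<exists>x. \<forall>n. norm (x n - (if n = 0 then 0 else x (n - 1))) \<le> (1 / 3) ^ n \<and>
      2 / 3 * (1 / 3) ^ n * norm (U n) \<le> norm (U n (x n))"
  proof -
    define step where "step n y = (SOME z. norm (z - y) \<le> (1/3)^n \<and> 2 / 3 * (1/3)^n * norm (U n) \<le> norm (U n z))" for n y
    have step: "norm (step n y - y) \<le> (1/3)^n \<and> 2 / 3 * (1/3)^n * norm (U n) \<le> norm (U n (step n y))" for n y
      unfolding step_def by (rule someI_ex[OF blinfun_large_value_near]) simp
    define x where "x = rec_nat (step 0 0) (\<lambda>n. step (Suc n))"
    have "x n = step n (if n = 0 then 0 else x (n - 1))" for n by (cases n) (auto simp: x_def)
    then have "norm (x n - (if n = 0 then 0 else x (n - 1))) \<le> (1 / 3) ^ n \<and>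
      2 / 3 * (1 / 3) ^ n * norm (U n) \<le> norm (U n (x n))" for n
      using step[of n "if n = 0 then 0 else x (n - 1)"] by simp
    then show ?thesis by blast
  qed
  then obtain x where x: "norm (x n - (if n = 0 then 0 else x (n - 1))) \<le> (1 / 3) ^ n"
      and big: "2 / 3 * (1 / 3) ^ n * norm (U n) \<le> norm (U n (x n))" for n by blast
  have step: "norm (x (Suc n) - x n) \<le> (1 / 3) ^ Suc n" for n
    using x[of "Suc n"] by simp
  \<comment> \<open>The factor \<open>1 - (1 / 3) ^ k\<close> records the exact partial geometric
    sum, which lets the induction close.\<close>
  have close: "norm (x (n + k) - x n) \<le> 1 / 2 * (1 / 3) ^ n * (1 - (1 / 3) ^ k)" for n k
  proof (induction k)
    case (Suc k)
    have "norm (x (n + Suc k) - x n) \<le> norm (x (Suc (n + k)) - x (n + k)) + norm (x (n + k) - x n)"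
      using norm_triangle_ineq[of "x (Suc (n + k)) - x (n + k)" "x (n + k) - x n"] by simp
    also have "\<dots> \<le> (1 / 3) ^ Suc (n + k) + 1 / 2 * (1 / 3) ^ n * (1 - (1 / 3) ^ k)"
      by (intro add_mono step Suc.IH)
    also have "\<dots> = 1 / 2 * (1 / 3) ^ n * (1 - (1 / 3) ^ Suc k)"
      by (simp add: power_add field_simps)
    finally show ?case .
  qed simp
  have close': "norm (x (n + k) - x n) \<le> 1 / 2 * (1 / 3) ^ n" for n k
    by (rule order_trans[OF close]) (simp add: mult_left_le)
  have "Cauchy x"
  proof (rule CauchyI')
    fix e :: real assume "e > 0"
    then obtain M where M: "(1 / 3) ^ M < e" using real_arch_pow_inv[of e "1 / 3"] by auto
    show "\<exists>M. \<forall>m\<ge>M. \<forall>n>m. dist (x m) (x n) < e"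
      unfolding dist_norm
    proof (intro exI allI impI)
      fix m n :: nat assume mn: "M \<le> m" "m < n"
      have "norm (x m - x n) \<le> 1 / 2 * (1 / 3) ^ m"
        using close'[of m "n - m"] mn by (simp add: norm_minus_commute)
      also have "\<dots> \<le> 1 * (1 / 3) ^ M" using mn by (intro mult_mono power_decreasing) auto
      finally show "norm (x m - x n) < e" using M by simp
    qed
  qed
  then obtain l where l: "x \<longlonglongrightarrow> l" by (auto simp: Cauchy_convergent_iff convergent_def)
  have lx: "norm (l - x n) \<le> 1 / 2 * (1 / 3) ^ n" for n
  proof (rule tendsto_upperbound)
    show "(\<lambda>k. norm (x (k + n) - x n)) \<longlonglongrightarrow> norm (l - x n)"
      by (intro tendsto_intros LIMSEQ_ignore_initial_segment l)
    show "eventually (\<lambda>k. norm (x (k + n) - x n) \<le> 1 / 2 * (1 / 3) ^ n) sequentially"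
      using close'[of n] by (intro always_eventually allI) (simp only: add.commute)
  qed simp
  \<comment> \<open>Here \<open>1 / 6\<close> is \<open>2 / 3 - 1 / 2\<close>, the gain at step
    \<open>n\<close> minus the loss in all later steps, and \<open>4 / 3\<close> is the growth rate
    4 of the norms times the shrinking rate \<open>1 / 3\<close> of the steps.\<close>
  have lower: "1 / 6 * (4 / 3) ^ n \<le> norm (U n l)" for n
  proof -
    have "1 / 6 * (4 / 3) ^ n = 1 / 6 * (((1 / 3) * (4::real)) ^ n)" by simp
    also have "\<dots> = 1 / 6 * (1 / 3) ^ n * 4 ^ n" by (simp only: power_mult_distrib mult.assoc)
    also have "\<dots> \<le> 1 / 6 * (1 / 3) ^ n * norm (U n)" by (intro mult_left_mono large) auto
    also have "\<dots> = 2 / 3 * (1 / 3) ^ n * norm (U n) - norm (U n) * (1 / 2 * (1 / 3) ^ n)" by simp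
    also have "\<dots> \<le> norm (U n (x n)) - norm (U n (l - x n))"
      using big[of n] norm_blinfun[of "U n" "l - x n"] mult_left_mono[OF lx[of n], of "norm (U n)"]
      by (simp add: mult.commute[of "norm (U n)"])
    also have "\<dots> \<le> norm (U n l)"
      using norm_triangle_ineq4[of "U n l" "U n (l - x n)"] by (simp add: blinfun.diff_right)
    finally show ?thesis .
  qed
  have "\<not> bounded (range (\<lambda>n. U n l))"
  proof
    assume "bounded (range (\<lambda>n. U n l))"
    then obtain B where B: "\<And>n. norm (U n l) \<le> B" by (auto simp: bounded_iff)
    obtain n where "6 * B < (4 / 3) ^ n" using real_arch_pow[of "4/3" "6 * B"] by auto
    then show False using lower[of n] B[of n] by simp
  qed
  then show ?thesis ..
qed

lemma has_vector_derivative_iff_tendsto: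
  "(f has_vector_derivative d) (at x) \<longleftrightarrow> ((\<lambda>y. (f y - f x) /\<^sub>R (y - x)) \<longlongrightarrow> d) (at x)"
proof -
  have "norm (f y - f x - (y - x) *\<^sub>R d) / norm (y - x) = norm ((f y - f x) /\<^sub>R (y - x) - d)"
    if "y \<noteq> x" for y
  proof -
    have "(f y - f x) /\<^sub>R (y - x) - d = (f y - f x - (y - x) *\<^sub>R d) /\<^sub>R (y - x)"
      using that by (simp add: scaleR_diff_right)
    then show ?thesis by (simp add: divide_inverse mult.commute)
  qed
  then have "((\<lambda>y. norm (f y - f x - (y - x) *\<^sub>R d) / norm (y - x)) \<longlongrightarrow> 0) (at x) \<longleftrightarrow>
      ((\<lambda>y. norm ((f y - f x) /\<^sub>R (y - x) - d)) \<longlongrightarrow> 0) (at x)"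
    by (intro tendsto_cong) (auto simp: eventually_at_filter)
  then show ?thesis
    unfolding has_vector_derivative_def has_derivative_iff_norm
    by (simp add: bounded_linear_scaleR_left tendsto_norm_zero_iff LIM_zero_iff)
qed

section \<open>Exponential bounds for strongly continuous semigroups\<close>

text \<open>Otherwise there are times tending to 0 at which the norms exceed \<open>4 ^ n\<close>,
  and uniform boundedness yields an orbit unbounded along them, contradicting its convergence at
  0.\<close>

lemma C0_semigroup_locally_bounded:
  fixes T :: "real \<Rightarrow> 'a::banach \<Rightarrow>\<^sub>L 'a"
  assumes "C0_semigroup T"
  shows "\<exists>\<delta>>0. \<exists>B. \<forall>t\<in>{0..\<delta>}. norm (T t) \<le> B"
proof (rule ccontr)
  assume neg: "\<not> (\<exists>\<delta>>0. \<exists>B. \<forall>t\<in>{0..\<delta>}. norm (T t) \<le> B)"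
  have "\<exists>t. 0 \<le> t \<and> t \<le> inverse (real (Suc n)) \<and> 4 ^ n \<le> norm (T t)" for n
  proof (rule ccontr)
    assume "\<nexists>t. 0 \<le> t \<and> t \<le> inverse (real (Suc n)) \<and> 4 ^ n \<le> norm (T t)"
    then have "\<forall>t\<in>{0..inverse (real (Suc n))}. norm (T t) \<le> 4 ^ n" by force
    with neg show False by (metis inverse_positive_iff_positive of_nat_0_less_iff zero_less_Suc)
  qed
  then obtain t where t: "\<And>n. 0 \<le> t n" "\<And>n. t n \<le> inverse (real (Suc n))" "\<And>n. 4 ^ n \<le> norm (T (t n))"
    by metis
  from uniform_boundedness[of "\<lambda>n. T (t n)"] t(3)
  obtain x where x: "\<not> bounded (range (\<lambda>n. T (t n) x))" by blast
  have "t \<longlonglongrightarrow> 0"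
    using t(1,2) by (intro tendsto_sandwich[OF _ _ tendsto_const LIMSEQ_inverse_real_of_nat]) auto
  have T0: "T 0 x = x" using assms by (simp add: C0_semigroup_def)
  have "continuous (at 0 within {0..}) (\<lambda>t. T t x)"
    using assms T0 by (simp add: continuous_within C0_semigroup_def at_within_Ici_at_right)
  then have "(\<lambda>n. T (t n) x) \<longlonglongrightarrow> T 0 x"
    by (rule continuous_within_tendsto_compose) (use t(1) \<open>t \<longlonglongrightarrow> 0\<close> in auto)
  then have "bounded (range (\<lambda>n. T (t n) x))" by (rule convergent_imp_bounded)
  with x show False ..
qed

text \<open>Covering \<open>[0, t]\<close> by steps of length at most \<open>\<delta>\<close> costs
  a factor \<open>B\<close> per step; about \<open>t / \<delta>\<close> steps give the rate
  \<open>ln B / \<delta>\<close>.\<close>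

lemma C0_semigroup_exp_bound:
  fixes T :: "real \<Rightarrow> 'a::banach \<Rightarrow>\<^sub>L 'a"
  assumes "C0_semigroup T"
  shows "\<exists>M\<ge>1. \<exists>\<nu>. \<forall>t\<ge>0. norm (T t) \<le> M * exp (\<nu> * t)"
proof -
  obtain \<delta> B0 where "\<delta> > 0" and B0: "\<And>t. 0 \<le> t \<Longrightarrow> t \<le> \<delta> \<Longrightarrow> norm (T t) \<le> B0"
    using C0_semigroup_locally_bounded[OF assms] by (metis atLeastAtMost_iff)
  \<comment> \<open>With \<open>B \<ge> 1\<close> the powers increase and \<open>ln B\<close> is
    nonnegative, so surplus steps do no harm.\<close>
  define B where "B = max 1 B0"
  have B: "B \<ge> 1" "\<And>t. 0 \<le> t \<Longrightarrow> t \<le> \<delta> \<Longrightarrow> norm (T t) \<le> B" using B0 by (force simp: B_def)+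
  have step: "norm (T t) \<le> B ^ Suc n" if "0 \<le> t" "t \<le> real (Suc n) * \<delta>" for t n
    using that
  proof (induction n arbitrary: t)
    case (Suc n)
    show ?case
    proof (cases "t \<le> \<delta>")
      case True
      then have "norm (T t) \<le> B" using Suc.prems B by simp
      also have "\<dots> \<le> B ^ Suc (Suc n)" using B(1) by (intro self_le_power) auto
      finally show ?thesis .
    next
      case False
      with Suc.prems \<open>\<delta> > 0\<close> have "norm (T (t - \<delta>)) \<le> B ^ Suc n"
        by (intro Suc.IH) (auto simp: algebra_simps)
      moreover have "T t = T \<delta> o\<^sub>L T (t - \<delta>)"
        using assms False \<open>\<delta> > 0\<close> unfolding C0_semigroup_def
        by (metis add.commute diff_add_cancel diff_ge_0_iff_ge less_imp_le linorder_not_le)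
      moreover have "norm (T \<delta>) \<le> B" using B \<open>\<delta> > 0\<close> by simp
      ultimately have "norm (T t) \<le> B * B ^ Suc n"
        using B(1) by (auto intro!: order_trans[OF norm_blinfun_compose] mult_mono)
      then show ?thesis by simp
    qed
  qed (use B in auto)
  have "norm (T t) \<le> B * exp (ln B / \<delta> * t)" if "t \<ge> 0" for t
  proof -
    define n where "n = nat \<lfloor>t / \<delta>\<rfloor>"
    have "real n = of_int \<lfloor>t / \<delta>\<rfloor>" using that \<open>\<delta> > 0\<close> by (simp add: n_def)
    then have n: "real n \<le> t / \<delta>" "t / \<delta> \<le> real (Suc n)" by linarith+
    then have "norm (T t) \<le> B ^ Suc n" using that \<open>\<delta> > 0\<close> by (intro step) (auto simp: field_simps)
    also have "\<dots> = B * exp (ln B * real n)" using B(1) by (simp add: exp_of_nat2_mult)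
    also have "\<dots> \<le> B * exp (ln B * (t / \<delta>))"
      using B(1) mult_left_mono[OF n(1), of "ln B"] by (intro mult_left_mono) auto
    finally show ?thesis by simp
  qed
  with B(1) show ?thesis by blast
qed

section \<open>Orbits, mild solutions and the exponential shift\<close>

locale c0_semigroup =
  fixes S :: "real \<Rightarrow> 'a::banach \<Rightarrow>\<^sub>L 'a" and M \<nu> :: real
  assumes C0: "C0_semigroup S" and M: "M \<ge> 1"
    and bound: "\<And>t. t \<ge> 0 \<Longrightarrow> norm (S t) \<le> M * exp (\<nu> * t)"
begin

lemma S_0: "S 0 x = x"
  using C0 by (simp add: C0_semigroup_def)

lemma S_add: "s \<ge> 0 \<Longrightarrow> t \<ge> 0 \<Longrightarrow> S (s + t) x = S s (S t x)"
  using C0 by (simp add: C0_semigroup_def)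

lemma norm_S_le: 
  assumes "0 \<le> t" "t \<le> b"
  shows "norm (S t) \<le> M * exp (\<bar>\<nu>\<bar> * b)"
proof -
  have "\<nu> * t \<le> \<bar>\<nu>\<bar> * b" using assms by (intro mult_mono) auto
  then have "M * exp (\<nu> * t) \<le> M * exp (\<bar>\<nu>\<bar> * b)" using M by (intro mult_left_mono) auto
  then show ?thesis using bound[OF assms(1)] by simp
qed

text \<open>Factoring out the smaller of the two times leaves \<open>S h x - x\<close> with small
  \<open>h\<close>, so left and right continuity both reduce to right continuity at 0 and a local
  norm bound.\<close>

lemma continuous_on_orbit: "continuous_on {0..} (\<lambda>t. S t x)"
proof (unfold continuous_on_iff, intro ballI allI impI)
  fix t e :: real assume t: "t \<in> {0..}" and "e > 0"
  define B where "B = M * exp (\<bar>\<nu>\<bar> * t)"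
  have "B > 0" using M by (simp add: B_def)
  have "((\<lambda>t. S t x) \<longlongrightarrow> x) (at_right 0)" using C0 by (simp add: C0_semigroup_def)
  then have "eventually (\<lambda>h. dist (S h x) x < e / B) (at_right 0)"
    using \<open>e > 0\<close> \<open>B > 0\<close> by (intro tendstoD) auto
  then obtain d where "d > 0" and d0: "\<And>h. 0 < h \<Longrightarrow> h < d \<Longrightarrow> dist (S h x) x < e / B"
    unfolding eventually_at_right_field by auto
  have d: "norm (S h x - x) < e / B" if "0 \<le> h" "h < d" for h
    using d0[of h] that \<open>e > 0\<close> \<open>B > 0\<close> by (cases "h = 0") (auto simp: S_0 dist_norm)
  have "dist (S s x) (S t x) < e" if "s \<in> {0..}" "dist s t < d" for s
  proof -
    define m where "m = min s t"
    define h where "h = \<bar>s - t\<bar>"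
    have m: "0 \<le> m" "m \<le> t" and h: "0 \<le> h" "h < d" using t that by (auto simp: m_def h_def dist_real_def)
    have "norm (S s x - S t x) = norm (S (m + h) x - S m x)"
      by (cases "s \<le> t") (auto simp: m_def h_def norm_minus_commute)
    also have "\<dots> = norm (S m (S h x - x))" using m h by (simp add: S_add blinfun.diff_right)
    also have "\<dots> \<le> B * norm (S h x - x)"
      unfolding B_def by (intro order_trans[OF norm_blinfun] mult_right_mono norm_S_le m) auto
    also have "\<dots> < e" using d[OF h] \<open>B > 0\<close> by (simp add: field_simps)
    finally show ?thesis by (simp add: dist_norm)
  qed
  with \<open>d > 0\<close> show "\<exists>d>0. \<forall>s\<in>{0..}. dist s t < d \<longrightarrow> dist (S s x) (S t x) < e" by blast
qed

text \<open>Joint strong continuity: the local norm bound absorbs the moving argument, and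
  continuity of one orbit absorbs the moving time.\<close>

lemma tendsto_S:
  assumes r: "(r \<longlongrightarrow> r0) F" "r0 \<ge> 0" "eventually (\<lambda>i. r i \<ge> 0) F" and x: "(x \<longlongrightarrow> x0) F"
  shows "((\<lambda>i. S (r i) (x i)) \<longlongrightarrow> S r0 x0) F"
proof -
  define B where "B = M * exp (\<bar>\<nu>\<bar> * (r0 + 1))"
  have "eventually (\<lambda>i. r i < r0 + 1) F" using r(1) by (rule order_tendstoD) simp
  with r(3) have "eventually (\<lambda>i. norm (S (r i) (x i - x0)) \<le> norm (x i - x0) * B) F"
  proof eventually_elim
    fix i assume "0 \<le> r i" "r i < r0 + 1"
    then have "norm (S (r i)) \<le> B" unfolding B_def by (intro norm_S_le) auto
    then show "norm (S (r i) (x i - x0)) \<le> norm (x i - x0) * B"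
      by (intro order_trans[OF norm_blinfun]) (simp add: mult.commute[of _ B] mult_right_mono)
  qed
  then have "((\<lambda>i. S (r i) (x i - x0)) \<longlongrightarrow> 0) F"
    by (rule tendsto_0_le[OF LIM_zero[OF x]])
  moreover have "((\<lambda>i. S (r i) x0) \<longlongrightarrow> S r0 x0) F"
    using r by (intro continuous_on_tendsto_compose[OF continuous_on_orbit]) auto
  ultimately have "((\<lambda>i. S (r i) (x i - x0) + S (r i) x0) \<longlongrightarrow> 0 + S r0 x0) F" by (rule tendsto_add)
  then show ?thesis by (simp add: blinfun.diff_right)
qed

lemma continuous_on_S [continuous_intros]:
  assumes "continuous_on A r" "continuous_on A x" "\<And>a. a \<in> A \<Longrightarrow> r a \<ge> 0"
  shows "continuous_on A (\<lambda>a. S (r a) (x a))"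
  unfolding continuous_on_def
proof
  fix a assume "a \<in> A"
  have "eventually (\<lambda>a. a \<in> A) (at a within A)" by (simp add: eventually_at_filter)
  then have "eventually (\<lambda>a. r a \<ge> 0) (at a within A)" by eventually_elim (rule assms)
  then show "((\<lambda>a. S (r a) (x a)) \<longlongrightarrow> S (r a) (x a)) (at a within A)"
    using assms \<open>a \<in> A\<close> by (intro tendsto_S) (auto simp: continuous_on_def)
qed

lemma continuous_on_conv:
  assumes "continuous_on UNIV g" "b \<le> t"
  shows "continuous_on {a..b} (\<lambda>r. S (t - r) (g r))"
  using assms(2) by (intro continuous_intros continuous_on_subset[OF assms(1)]) auto

lemma integrable_conv:
  assumes "continuous_on UNIV g" "b \<le> t"
  shows "(\<lambda>r. S (t - r) (g r)) integrable_on {a..b}"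
  by (intro integrable_continuous_real continuous_on_conv assms)

lemma S_integral_conv:
  assumes "continuous_on UNIV g" "b \<le> t" "h \<ge> 0"
  shows "S h (integral {a..b} (\<lambda>r. S (t - r) (g r))) = integral {a..b} (\<lambda>r. S (t + h - r) (g r))"
proof -
  have "S h (integral {a..b} (\<lambda>r. S (t - r) (g r))) = integral {a..b} (\<lambda>r. S h (S (t - r) (g r)))"
    by (rule integral_blinfun_apply[symmetric]) (rule integrable_conv[OF assms(1,2)])
  also have "\<dots> = integral {a..b} (\<lambda>r. S (t + h - r) (g r))"
  proof (rule integral_cong)
    fix r assume "r \<in> {a..b}"
    then show "S h (S (t - r) (g r)) = S (t + h - r) (g r)"
      using S_add[of h "t - r" "g r"] assms(2,3) by (simp add: algebra_simps)
  qed
  finally show ?thesis .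
qed

definition mild :: "(real \<Rightarrow> 'a) \<Rightarrow> (real \<Rightarrow> 'a) \<Rightarrow> bool" where
  "mild g u \<longleftrightarrow> (\<forall>s t. s \<le> t \<longrightarrow> u t = S (t - s) (u s) + integral {s..t} (\<lambda>r. S (t - r) (g r)))"

text \<open>For fixed \<open>t\<close> the function \<open>r \<mapsto> S (t - r) (u r)\<close> is differentiable even though \<open>u\<close> itself
  need not be.\<close>

lemma mild_has_vector_derivative:
  assumes g: "continuous_on UNIV g" and "mild g u" and "s \<le> t" and r: "r \<in> {s..t}"
  shows "((\<lambda>r. S (t - r) (u r)) has_vector_derivative S (t - r) (g r)) (at r within {s..t})"
proof (rule has_vector_derivative_transform[OF r])
  fix r assume r: "r \<in> {s..t}"
  have "u r = S (r - s) (u s) + integral {s..r} (\<lambda>q. S (r - q) (g q))"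
    using \<open>mild g u\<close> r by (simp add: mild_def)
  then have "S (t - r) (u r) = S (t - r) (S (r - s) (u s)) + S (t - r) (integral {s..r} (\<lambda>q. S (r - q) (g q)))"
    by (metis blinfun.add_right)
  \<comment> \<open>After \<open>S (t - r)\<close> is moved inside, \<open>r\<close> survives only
    as the upper limit of integration.\<close>
  also have "\<dots> = S (t - s) (u s) + integral {s..r} (\<lambda>q. S (t - q) (g q))"
    using S_integral_conv[OF g order_refl, of "t - r" s r] S_add[of "t - r" "r - s" "u s"] r by simp
  finally show "S (t - r) (u r) = S (t - s) (u s) + integral {s..r} (\<lambda>q. S (t - q) (g q))" .
next
  show "((\<lambda>r. S (t - s) (u s) + integral {s..r} (\<lambda>q. S (t - q) (g q))) has_vector_derivative S (t - r) (g r)) (at r within {s..t})"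
    using integral_has_vector_derivative[OF continuous_on_conv[OF g order_refl] r]
    by (auto intro!: derivative_eq_intros)
qed

lemma shifted: "c0_semigroup (shifted_semigroup C S) M (\<nu> - C)"
proof
  have "((\<lambda>t. exp (- C * t) *\<^sub>R S t x) \<longlongrightarrow> exp (- C * 0) *\<^sub>R x) (at_right 0)" for x
    using C0 by (intro tendsto_intros) (simp add: C0_semigroup_def)
  moreover have "exp (- C * (s + t)) *\<^sub>R S (s + t) = (exp (- C * s) *\<^sub>R S s) o\<^sub>L (exp (- C * t) *\<^sub>R S t)"
    if "s \<ge> 0" "t \<ge> 0" for s t
  proof -
    have "exp (- C * (s + t)) = exp (- C * s) * exp (- C * t)"
      by (simp add: mult_exp_exp algebra_simps)
    then show ?thesis
      by (intro blinfun_eqI) (simp add: S_add that blinfun.scaleR_left blinfun.scaleR_right)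
  qed
  ultimately show "C0_semigroup (shifted_semigroup C S)"
    using C0 unfolding C0_semigroup_def shifted_semigroup_def by (simp add: blinfun.scaleR_left)
  fix t :: real assume "t \<ge> 0"
  then have "exp (- C * t) * norm (S t) \<le> exp (- C * t) * (M * exp (\<nu> * t))"
    by (intro mult_left_mono bound) auto
  also have "\<dots> = M * exp ((\<nu> - C) * t)" by (simp add: mult_exp_exp algebra_simps)
  finally show "norm (shifted_semigroup C S t) \<le> M * exp ((\<nu> - C) * t)" by (simp add: shifted_semigroup_def)
qed (rule M)

text \<open>The derivative of \<open>exp (- C * (t - r)) *\<^sub>R S (t - r) (u r)\<close> in
  \<open>r\<close> is exactly the integrand of the shifted equation, so one integration replaces an
  exchange of iterated integrals. As \<open>C\<close> may be negative, the lemma also serves for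
  shifting back.\<close>

lemma mild_shifted:
  assumes g: "continuous_on UNIV g" and u: "continuous_on UNIV u" and "mild g u"
  shows "c0_semigroup.mild (shifted_semigroup C S) (\<lambda>r. g r + C *\<^sub>R u r) u"
  unfolding c0_semigroup.mild_def[OF shifted]
proof (intro allI impI)
  fix s t :: real assume "s \<le> t"
  define \<phi> where "\<phi> r = exp (- C * (t - r)) *\<^sub>R S (t - r) (u r)" for r
  have "((\<lambda>r. shifted_semigroup C S (t - r) (g r + C *\<^sub>R u r)) has_integral \<phi> t - \<phi> s) {s..t}"
  proof (rule fundamental_theorem_of_calculus[OF \<open>s \<le> t\<close>])
    fix r assume "r \<in> {s..t}"
    have "((\<lambda>r. exp (- C * (t - r))) has_field_derivative C * exp (- C * (t - r))) (at r within {s..t})"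
      by (auto intro!: derivative_eq_intros)
    from has_vector_derivative_scaleR[OF this mild_has_vector_derivative[OF g \<open>mild g u\<close> \<open>s \<le> t\<close> \<open>r \<in> {s..t}\<close>]]
    show "(\<phi> has_vector_derivative shifted_semigroup C S (t - r) (g r + C *\<^sub>R u r)) (at r within {s..t})"
      by (simp add: \<phi>_def[abs_def] shifted_semigroup_def blinfun.add_right blinfun.scaleR_left blinfun.scaleR_right scaleR_add_right mult.commute)
  qed
  then have "integral {s..t} (\<lambda>r. shifted_semigroup C S (t - r) (g r + C *\<^sub>R u r)) = \<phi> t - \<phi> s"
    by (rule integral_unique)
  then show "u t = shifted_semigroup C S (t - s) (u s)
      + integral {s..t} (\<lambda>r. shifted_semigroup C S (t - r) (g r + C *\<^sub>R u r))"
    by (simp add: \<phi>_def S_0 shifted_semigroup_def blinfun.scaleR_left)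
qed

text \<open>The generator supplies only a right derivative at 0. Quotients from either side of
  \<open>t\<close> are \<open>S (min s t)\<close> applied to a quotient at 0 with step
  \<open>\<bar>s - t\<bar>\<close>, and joint continuity allows the base time to move.\<close>

lemma orbit_has_vector_derivative:
  assumes gen: "generates D B S" and "x \<in> D" and "t > 0"
  shows "((\<lambda>t. S t x) has_vector_derivative S t (B x)) (at t)"
  unfolding has_vector_derivative_iff_tendsto
proof (rule Lim_transform_eventually)
  have "((\<lambda>h. (S h x - x) /\<^sub>R h) \<longlongrightarrow> B x) (at_right 0)"
    using gen \<open>x \<in> D\<close> by (auto simp: generates_def)
  moreover have "filterlim (\<lambda>s. \<bar>s - t\<bar>) (at_right 0) (at t)"
    by (rule filterlim_at_withinI) (auto intro!: tendsto_eq_intros simp: eventually_at_filter)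
  ultimately have "((\<lambda>s. (S \<bar>s - t\<bar> x - x) /\<^sub>R \<bar>s - t\<bar>) \<longlongrightarrow> B x) (at t)"
    by (rule filterlim_compose)
  moreover have "((\<lambda>s. min s t) \<longlongrightarrow> t) (at t)" by (auto intro!: tendsto_eq_intros)
  moreover from order_tendstoD(1)[OF this \<open>t > 0\<close>] have "eventually (\<lambda>s. min s t \<ge> 0) (at t)"
    by eventually_elim simp
  ultimately show "((\<lambda>s. S (min s t) ((S \<bar>s - t\<bar> x - x) /\<^sub>R \<bar>s - t\<bar>)) \<longlongrightarrow> S t (B x)) (at t)"
    using \<open>t > 0\<close> by (intro tendsto_S) auto
  have "S (min s t) ((S \<bar>s - t\<bar> x - x) /\<^sub>R \<bar>s - t\<bar>) = (S s x - S t x) /\<^sub>R (s - t)" if "s > 0" for s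
  proof (cases "s \<le> t")
    case True
    then have "S (min s t) ((S \<bar>s - t\<bar> x - x) /\<^sub>R \<bar>s - t\<bar>) = (S t x - S s x) /\<^sub>R (t - s)"
      using that S_add[of s "t - s" x] by (simp add: blinfun.scaleR_right blinfun.diff_right)
    also have "\<dots> = (S s x - S t x) /\<^sub>R (s - t)"
      by (metis minus_diff_eq scaleR_minus_left scaleR_minus_right inverse_minus_eq minus_minus)
    finally show ?thesis .
  next
    case False
    then show ?thesis
      using \<open>t > 0\<close> S_add[of t "s - t" x] by (simp add: blinfun.scaleR_right blinfun.diff_right)
  qed
  moreover have "eventually (\<lambda>s. s > 0) (at t)"
    using order_tendstoD(1)[OF tendsto_ident_at \<open>t > 0\<close>] .
  ultimately show "eventually (\<lambda>s. S (min s t) ((S \<bar>s - t\<bar> x - x) /\<^sub>R \<bar>s - t\<bar>) = (S s x - S t x) /\<^sub>R (s - t)) (at t)"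
    by (auto elim: eventually_mono)
qed

text \<open>A product rule for \<open>S (t - r) (v r)\<close> under strong continuity alone: the
  quotient splits into \<open>S (t - y)\<close> applied to the quotient of \<open>v\<close>, and an
  orbit quotient of the fixed vector \<open>v r\<close>.\<close>

lemma mild_of_strict:
  assumes gen: "generates D B S" and D: "\<And>r. v r \<in> D"
    and v: "\<And>r. (v has_vector_derivative v' r) (at r)"
  shows "mild (\<lambda>r. v' r - B (v r)) v"
  unfolding mild_def
proof (intro allI impI)
  fix s t :: real assume "s \<le> t"
  define \<phi> where "\<phi> r = S (t - r) (v r)" for r
  have "continuous_on UNIV v"
    using v by (auto simp: continuous_on_eq_continuous_at intro: has_vector_derivative_continuous)
  have "((\<lambda>r. S (t - r) (v' r - B (v r))) has_integral \<phi> t - \<phi> s) {s..t}"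
  \<comment> \<open>Only interior points are differentiated, because the two-sided orbit derivative
    requires \<open>t - r > 0\<close>.\<close>
  proof (rule fundamental_theorem_of_calculus_interior[OF \<open>s \<le> t\<close>])
    show "continuous_on {s..t} \<phi>"
      unfolding \<phi>_def by (intro continuous_on_conv order_refl) fact
    fix r assume r: "r \<in> {s<..<t}"
    have "((\<lambda>y. (v y - v r) /\<^sub>R (y - r)) \<longlongrightarrow> v' r) (at r)"
      using v[of r] by (simp only: has_vector_derivative_iff_tendsto)
    moreover have t_lim: "((\<lambda>y. t - y) \<longlongrightarrow> t - r) (at r)" by (auto intro!: tendsto_eq_intros)
    moreover from order_tendstoD(1)[OF t_lim, of 0] r have "eventually (\<lambda>y. t - y \<ge> 0) (at r)"
      by (auto elim: eventually_mono)
    ultimately have "((\<lambda>y. S (t - y) ((v y - v r) /\<^sub>R (y - r))) \<longlongrightarrow> S (t - r) (v' r)) (at r)"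
      using r by (intro tendsto_S) auto
    moreover have "((\<lambda>y. S (t - y) (v r)) has_vector_derivative - S (t - r) (B (v r))) (at r)"
    proof -
      have "((\<lambda>y. t - y) has_vector_derivative - 1) (at r)" by (auto intro!: derivative_eq_intros)
      moreover have "((\<lambda>t. S t (v r)) has_vector_derivative S (t - r) (B (v r))) (at (t - r))"
        using r by (intro orbit_has_vector_derivative[OF gen D]) simp
      ultimately show ?thesis using vector_diff_chain_at[of "\<lambda>y. t - y" "- 1" r] by (simp add: o_def)
    qed
    then have "((\<lambda>y. (S (t - y) (v r) - S (t - r) (v r)) /\<^sub>R (y - r)) \<longlongrightarrow> - S (t - r) (B (v r))) (at r)"
      by (simp only: has_vector_derivative_iff_tendsto)
    ultimately have "((\<lambda>y. S (t - y) ((v y - v r) /\<^sub>R (y - r)) + (S (t - y) (v r) - S (t - r) (v r)) /\<^sub>R (y - r))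
        \<longlongrightarrow> S (t - r) (v' r) + - S (t - r) (B (v r))) (at r)" by (rule tendsto_add)
    then show "(\<phi> has_vector_derivative S (t - r) (v' r - B (v r))) (at r)"
      unfolding has_vector_derivative_iff_tendsto \<phi>_def
      by (simp add: blinfun.scaleR_right blinfun.diff_right scaleR_add_right[symmetric])
  qed
  then have "integral {s..t} (\<lambda>r. S (t - r) (v' r - B (v r))) = \<phi> t - \<phi> s" by (rule integral_unique)
  then show "v t = S (t - s) (v s) + integral {s..t} (\<lambda>r. S (t - r) (v' r - B (v r)))"
    by (simp add: \<phi>_def S_0)
qed

end

subsection \<open>Periodic mild solutions\<close>

lemma C_per_bounded:
  assumes "g \<in> C_per \<omega>" and "\<omega> > 0"
  shows "\<exists>K. \<forall>t. norm (g t) \<le> K"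
proof -
  \<comment> \<open>Rescaled to period 1, reduction to the base interval is subtraction of the
    integer part of \<open>t / \<omega>\<close>.\<close>
  interpret periodic_fun_simple "\<lambda>t. g (t * \<omega>)" 1
    by unfold_locales (use assms(1) in \<open>simp add: C_per_def distrib_right\<close>)
  have "continuous_on {0..\<omega>} g" using assms(1) by (auto simp: C_per_def intro: continuous_on_subset)
  then have "bounded (g ` {0..\<omega>})" by (intro compact_imp_bounded compact_continuous_image) auto
  then obtain K where K: "\<And>t. t \<in> {0..\<omega>} \<Longrightarrow> norm (g t) \<le> K"
    unfolding bounded_iff by blast
  have "norm (g t) \<le> K" for t
  proof -
    have "0 \<le> frac (t / \<omega>) * \<omega>" "frac (t / \<omega>) * \<omega> \<le> 1 * \<omega>"
      using \<open>\<omega> > 0\<close> frac_lt_1[of "t / \<omega>"] by (auto intro!: mult_right_mono)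
    then have "norm (g (frac (t / \<omega>) * \<omega>)) \<le> K" by (intro K) simp
    moreover have "g (frac (t / \<omega>) * \<omega>) = g t"
      using minus_of_int[of "t / \<omega>" "\<lfloor>t / \<omega>\<rfloor>"] \<open>\<omega> > 0\<close> by (simp add: frac_def)
    ultimately show ?thesis by simp
  qed
  then show ?thesis by blast
qed

lemma C_per_minus_period: "g \<in> C_per \<omega> \<Longrightarrow> g (t - \<omega>) = g t"
  by (auto simp: C_per_def dest: spec[of _ "t - \<omega>"])

lemma uniform_limit_Pair:
  assumes "uniform_limit S f l X" and "uniform_limit S g m X"
  shows "uniform_limit S (\<lambda>i t. (f i t, g i t)) (\<lambda>t. (l t, m t)) X"
proof (rule uniform_limitI)
  fix e :: real assume "e > 0"
  then have "e / 2 > 0" by simp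
  from uniform_limitD[OF assms(1) this] uniform_limitD[OF assms(2) this]
  show "eventually (\<lambda>i. \<forall>t\<in>S. dist (f i t, g i t) (l t, m t) < e) X"
  proof eventually_elim
    case (elim i)
    have "dist (f i t, g i t) (l t, m t) < e" if "t \<in> S" for t
    proof -
      have "dist (f i t, g i t) (l t, m t) \<le> dist (f i t) (l t) + dist (g i t) (m t)"
        by (simp add: dist_Pair_Pair sqrt_sum_squares_le_sum)
      also have "\<dots> < e" using elim that by (metis add_strict_mono field_sum_of_halves)
      finally show ?thesis .
    qed
    then show ?case by blast
  qed
qed

lemma converges_in_C_per_uniform:
  assumes "\<And>i. u i \<in> C_per \<omega>" "l \<in> C_per \<omega>" and "\<omega> > 0" and unif: "uniform_limit {0..\<omega>} u l sequentially"
  shows "converges_in_C_per \<omega> u l"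
proof -
  have "(\<lambda>i. norm_C \<omega> (\<lambda>t. u i t - l t)) \<longlonglongrightarrow> 0"
  proof (rule tendstoI)
    fix e :: real assume "e > 0"
    then have "e / 2 > 0" by simp
    from uniform_limitD[OF unif this]
    show "eventually (\<lambda>i. dist (norm_C \<omega> (\<lambda>t. u i t - l t)) 0 < e) sequentially"
    proof eventually_elim
      case (elim i)
      then have le: "norm (u i t - l t) \<le> e / 2" if "t \<in> {0..\<omega>}" for t
        using that by (auto simp: dist_norm intro: less_imp_le)
      then have "norm_C \<omega> (\<lambda>t. u i t - l t) \<le> e / 2"
        unfolding norm_C_def using \<open>\<omega> > 0\<close> by (intro cSUP_least) auto
      moreover have "norm (u i 0 - l 0) \<le> norm_C \<omega> (\<lambda>t. u i t - l t)"
        unfolding norm_C_def using \<open>\<omega> > 0\<close> le by (intro cSUP_upper bdd_aboveI2[of _ _ "e / 2"]) auto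
      ultimately show ?case
        using \<open>e > 0\<close> norm_ge_zero[of "u i 0 - l 0"] unfolding dist_real_def by linarith
    qed
  qed
  then show ?thesis using assms by (auto simp: converges_in_C_per_def)
qed

context c0_semigroup
begin

text \<open>Both \<open>u s\<close> and \<open>u t\<close> are compared through the value of \<open>u\<close> at the earlier time \<open>s - a\<close>,
  which brings in \<open>S\<close> only at times near \<open>a > 0\<close>, where it is norm continuous.\<close>

lemma mild_equicontinuous:
  assumes cont: "continuous_on {0<..} S"
    and g: "\<And>i. continuous_on UNIV (g i)" and mild: "\<And>i. mild (g i) (u i)"
    and K: "\<And>i t. norm (u i t) \<le> K" "\<And>i t. norm (g i t) \<le> K" and "e > 0"
  shows "\<exists>d>0. \<forall>i s t. dist s t < d \<longrightarrow> dist (u i s) (u i t) < e"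
proof -
  define K' where "K' = max K 1"
  define B where "B = M * exp (\<bar>\<nu>\<bar> * 1)"
  have K': "K' \<ge> 1" "\<And>i t. norm (u i t) \<le> K'" "\<And>i t. norm (g i t) \<le> K'"
    using K by (auto simp: K'_def intro: le_max_iff_disj[THEN iffD2])
  have "1 * 1 \<le> M * exp (\<bar>\<nu>\<bar> * 1)" using M by (intro mult_mono) auto
  then have "B \<ge> 1" by (simp add: B_def)
  have B: "norm (S h) \<le> B" if "0 \<le> h" "h \<le> 1" for h
    unfolding B_def using that by (rule norm_S_le)
  have conv_le: "norm (integral {b..t} (\<lambda>r. S (t - r) (g i r))) \<le> B * K' * (t - b)"
    if "b \<le> t" "t \<le> b + 1" for b t i
  proof (rule integral_bound[OF \<open>b \<le> t\<close> continuous_on_conv[OF g order_refl]])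
    fix r assume "r \<in> {b..t}"
    then show "norm (S (t - r) (g i r)) \<le> B * K'"
      using that \<open>B \<ge> 1\<close> by (intro order_trans[OF norm_blinfun] mult_mono B K') auto
  qed
  \<comment> \<open>The two integrals will contribute at most \<open>3 * e / 8\<close> and the
    difference of operators \<open>e / 4\<close>. The cap \<open>1 / 2\<close> keeps
    \<open>t - b \<le> 2 * a\<close> within \<open>[0, 1]\<close>, where \<open>B\<close> bounds
    \<open>S\<close>.\<close>
  define a where "a = min (1 / 2) (e / (8 * B * K'))"
  have pos: "8 * B * K' > 0" using \<open>B \<ge> 1\<close> K'(1) by simp
  have "a > 0" using \<open>e > 0\<close> pos by (simp add: a_def)
  have a: "a \<le> 1 / 2" "B * K' * a \<le> e / 8"
  proof -
    show "a \<le> 1 / 2" by (simp add: a_def)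
    have "a \<le> e / (8 * B * K')" by (simp add: a_def)
    then have "(B * K') * a \<le> (B * K') * (e / (8 * B * K'))"
      using \<open>B \<ge> 1\<close> K'(1) by (intro mult_left_mono) auto
    then show "B * K' * a \<le> e / 8" using \<open>B \<ge> 1\<close> K'(1) by simp
  qed
  have "e / (4 * K') > 0" using \<open>e > 0\<close> K'(1) by simp
  with cont \<open>a > 0\<close> obtain d' where "d' > 0"
    and d': "\<And>h. h > 0 \<Longrightarrow> dist h a < d' \<Longrightarrow> dist (S h) (S a) < e / (4 * K')"
    unfolding continuous_on_iff by (metis greaterThan_iff)
  define d where "d = min a d'"
  have "d > 0" using \<open>a > 0\<close> \<open>d' > 0\<close> by (simp add: d_def)
  have main: "norm (u i t - u i s) < e" if "s \<le> t" "t < s + d" for i s t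
  proof -
    define b where "b = s - a"
    define I where "I t = integral {b..t} (\<lambda>r. S (t - r) (g i r))" for t
    have st: "b \<le> s" "b \<le> t" "t \<le> b + 1" "s \<le> b + 1" "t - b \<le> 2 * a" "s - b = a" "t - b > 0"
      using that a(1) \<open>a > 0\<close> by (auto simp: b_def d_def)
    have It: "norm (I t) \<le> 2 * (e / 8)"
    proof -
      have "norm (I t) \<le> B * K' * (t - b)" unfolding I_def using st by (intro conv_le)
      also have "\<dots> \<le> B * K' * (2 * a)" using st \<open>B \<ge> 1\<close> K'(1) by (intro mult_left_mono) auto
      finally show ?thesis using a(2) by simp
    qed
    have Is: "norm (I s) \<le> e / 8"
      using conv_le[OF st(1,4), of i] st(6) a(2) by (simp add: I_def)
    have "dist (S (t - b)) (S a) < e / (4 * K')"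
      using st that by (intro d') (auto simp: dist_real_def b_def d_def)
    then have "norm (S (t - b) - S a) \<le> e / (4 * K')" by (simp add: dist_norm)
    then have "norm ((S (t - b) - S (s - b)) (u i b)) \<le> e / (4 * K') * K'"
      unfolding st(6)
      using K'(1) \<open>e > 0\<close> by (intro order_trans[OF norm_blinfun] mult_mono K') auto
    then have D: "norm ((S (t - b) - S (s - b)) (u i b)) \<le> e / 4" using K'(1) by simp
    have "u i t = S (t - b) (u i b) + I t" "u i s = S (s - b) (u i b) + I s"
      using mild[of i] st(1,2) by (auto simp: mild_def I_def)
    then have "u i t - u i s = (S (t - b) - S (s - b)) (u i b) + (I t - I s)"
      by (simp add: blinfun.diff_left)
    also have "norm \<dots> \<le> norm ((S (t - b) - S (s - b)) (u i b)) + (norm (I t) + norm (I s))"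
      by (intro order_trans[OF norm_triangle_ineq] add_left_mono norm_triangle_ineq4)
    finally show ?thesis using D It Is \<open>e > 0\<close> by linarith
  qed
  have "dist (u i s) (u i t) < e" if "dist s t < d" for i s t
    using main[of s t i] main[of t s i] that
    by (cases "s \<le> t") (auto simp: dist_norm dist_real_def norm_minus_commute)
  with \<open>d > 0\<close> show ?thesis by blast
qed

text \<open>The solutions enter only at the two times \<open>s\<close> and \<open>t\<close>, so
  pointwise convergence suffices for them; the right-hand sides stand under the integral and
  converge uniformly.\<close>

lemma mild_uniform_limit:
  assumes g: "\<And>i. continuous_on UNIV (g i)" and mild: "\<And>i. mild (g i) (u i)"
    and u: "\<And>t. (\<lambda>i. u i t) \<longlonglongrightarrow> l t"
    and unif: "\<And>a b. uniform_limit {a..b} g h sequentially"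
  shows "mild h l"
  unfolding mild_def
proof (intro allI impI)
  fix s t :: real assume "s \<le> t"
  define B where "B = M * exp (\<bar>\<nu>\<bar> * (t - s))"
  have "B > 0" using M by (simp add: B_def)
  have "uniform_limit {s..t} (\<lambda>i r. S (t - r) (g i r)) (\<lambda>r. S (t - r) (h r)) sequentially"
  proof (rule uniform_limitI)
    fix e :: real assume "e > 0"
    with \<open>B > 0\<close> have "e / B > 0" by simp
    from uniform_limitD[OF unif this, of s t]
    show "eventually (\<lambda>i. \<forall>r\<in>{s..t}. dist (S (t - r) (g i r)) (S (t - r) (h r)) < e) sequentially"
    proof eventually_elim
      case (elim i)
      have "dist (S (t - r) (g i r)) (S (t - r) (h r)) < e" if "r \<in> {s..t}" for r
      proof -
        have "norm (S (t - r)) \<le> B" unfolding B_def using that by (intro norm_S_le) auto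
        then have "norm (S (t - r) (g i r - h r)) \<le> B * norm (g i r - h r)"
          by (intro order_trans[OF norm_blinfun] mult_right_mono) auto
        also have "\<dots> < e" using elim that \<open>B > 0\<close> by (auto simp: dist_norm field_simps)
        finally show ?thesis by (simp add: dist_norm blinfun.diff_right)
      qed
      then show ?case by blast
    qed
  qed
  from uniform_limit_integral[OF this continuous_on_conv[OF g order_refl] sequentially_bot]
  obtain I J where I: "\<And>i. ((\<lambda>r. S (t - r) (g i r)) has_integral I i) {s..t}"
    and J: "((\<lambda>r. S (t - r) (h r)) has_integral J) {s..t}" and "I \<longlonglongrightarrow> J" by blast
  have "(\<lambda>i. S (t - s) (u i s) + I i) \<longlonglongrightarrow> S (t - s) (l s) + J"
    by (intro tendsto_intros u \<open>I \<longlonglongrightarrow> J\<close>)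
  moreover have "S (t - s) (u i s) + I i = u i t" for i
    using mild[of i] \<open>s \<le> t\<close> integral_unique[OF I[of i]] by (simp add: mild_def)
  ultimately have "(\<lambda>i. u i t) \<longlonglongrightarrow> S (t - s) (l s) + J" by simp
  then have "l t = S (t - s) (l s) + J" using u LIMSEQ_unique by blast
  then show "l t = S (t - s) (l s) + integral {s..t} (\<lambda>r. S (t - r) (h r))"
    using integral_unique[OF J] by simp
qed

end

section \<open>The periodic linear problem under exponential decay\<close>

locale stable_semigroup = c0_semigroup S M \<nu>
  for S :: "real \<Rightarrow> 'a::banach \<Rightarrow>\<^sub>L 'a" and M \<nu> +
  fixes \<omega> :: real
  assumes \<nu>: "\<nu> < 0" and \<omega>: "\<omega> > 0"
begin

text \<open>The Neumann series for the inverse of \<open>I - S \<omega>\<close>, with the powers of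
  \<open>S \<omega>\<close> written as values of the semigroup. In this form it inherits positivity
  from \<open>S\<close>.\<close>

definition resolvent :: "'a \<Rightarrow>\<^sub>L 'a" where
  "resolvent = (\<Sum>n. S (real n * \<omega>))"

lemma resolvent_sums: "(\<lambda>n. S (real n * \<omega>) x) sums resolvent x"
proof -
  have "summable (\<lambda>n. norm (S (real n * \<omega>)))"
  proof (rule summable_comparison_test')
    have "exp (\<nu> * \<omega>) < 1" using \<nu> \<omega> by (simp add: mult_neg_pos)
    then show "summable (\<lambda>n. M * exp (\<nu> * \<omega>) ^ n)" by (intro summable_mult summable_geometric) auto
    show "norm (norm (S (real n * \<omega>))) \<le> M * exp (\<nu> * \<omega>) ^ n" for n
      using bound[of "real n * \<omega>"] \<omega> by (simp add: exp_of_nat_mult[symmetric] ac_simps)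
  qed
  then have "(\<lambda>n. S (real n * \<omega>)) sums resolvent"
    unfolding resolvent_def by (rule summable_sums[OF summable_norm_cancel])
  then show ?thesis by (rule bounded_linear.sums[OF blinfun.bounded_linear_left])
qed

lemma resolvent_S:
  assumes "h \<ge> 0"
  shows "resolvent (S h x) = S h (resolvent x)"
proof -
  have "S (real n * \<omega>) (S h x) = S h (S (real n * \<omega>) x)" for n
    using S_add[of "real n * \<omega>" h x] S_add[of h "real n * \<omega>" x] assms \<omega> by (simp add: add.commute)
  then show ?thesis
    using resolvent_sums[of "S h x"] bounded_linear.sums[OF blinfun.bounded_linear_right resolvent_sums, of "S h" x]
    by (simp add: sums_unique2)
qed

lemma resolvent_eq: "resolvent x = x + resolvent (S \<omega> x)"
proof -
  have "S (real (Suc n) * \<omega>) x = S (real n * \<omega>) (S \<omega> x)" for n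
    using S_add[of "real n * \<omega>" \<omega> x] \<omega> by (simp add: algebra_simps)
  then have "(\<lambda>n. S (real (Suc n) * \<omega>) x) sums resolvent (S \<omega> x)"
    using resolvent_sums[of "S \<omega> x"] by simp
  then have "(\<lambda>n. S (real n * \<omega>) x) sums (resolvent (S \<omega> x) + S (real 0 * \<omega>) x)"
    by (rule sums_Suc)
  then show ?thesis using resolvent_sums[of x] sums_unique2 by (fastforce simp: S_0)
qed

lemma inv_eq_resolvent: "inv (blinfun_apply (id_blinfun - S \<omega>)) = blinfun_apply resolvent"
proof (rule inv_equality)
  show "resolvent ((id_blinfun - S \<omega>) x) = x" for x
    using resolvent_eq[of x] by (simp add: blinfun.diff_left blinfun.diff_right)
  show "(id_blinfun - S \<omega>) (resolvent x) = x" for x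
    using resolvent_eq[of x] resolvent_S[of \<omega> x] \<omega> by (simp add: blinfun.diff_left diff_eq_eq)
qed

text \<open>Over one period the mild equation for a periodic \<open>u\<close> reads
  \<open>u t = S \<omega> (u t)\<close> plus this integral; the formula solves it for
  \<open>u t\<close>.\<close>

definition per_sol :: "(real \<Rightarrow> 'a) \<Rightarrow> real \<Rightarrow> 'a" where
  "per_sol g t = resolvent (integral {t - \<omega>..t} (\<lambda>r. S (t - r) (g r)))"

lemma per_sol_unique:
  assumes "mild g u" and "u \<in> C_per \<omega>"
  shows "u = per_sol g"
proof
  fix t
  define P where "P = integral {t - \<omega>..t} (\<lambda>r. S (t - r) (g r))"
  have "u t = S \<omega> (u t) + P"
    using assms(1)[unfolded mild_def, rule_format, of "t - \<omega>" t] \<omega> C_per_minus_period[OF assms(2), of t]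
    by (simp add: P_def)
  then have "resolvent (u t) = resolvent (S \<omega> (u t)) + resolvent P" by (metis blinfun.add_right)
  then show "u t = per_sol g t" using resolvent_eq[of "u t"] by (simp add: per_sol_def P_def)
qed

lemma per_sol_C_per:
  assumes g: "g \<in> C_per \<omega>"
  shows "per_sol g \<in> C_per \<omega>"
proof -
  have cont: "continuous_on UNIV g" using g by (simp add: C_per_def)
  \<comment> \<open>Substitution fixes the interval of integration, so that \<open>t\<close> occurs
    only in \<open>g\<close>: continuity and periodicity in \<open>t\<close> are then inherited from
    \<open>g\<close>.\<close>
  have eq: "per_sol g t = resolvent (integral (cbox (- \<omega>) 0) (\<lambda>r. S (- r) (g (r + t))))" for t
    using integral_shift_real_ivl[of "t - \<omega>" t t "\<lambda>r. S (t - r) (g r)"] by (simp add: per_sol_def)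
  have "continuous_on UNIV (\<lambda>t. integral (cbox (- \<omega>) 0) (\<lambda>r. S (- r) (g (r + t))))"
  proof (rule integral_continuous_on_param)
    show "continuous_on (UNIV \<times> cbox (- \<omega>) 0) (\<lambda>(t, r). S (- r) (g (r + t)))"
      unfolding split_beta
      by (intro continuous_intros continuous_on_compose2[OF cont]) auto
  qed
  then have "continuous_on UNIV (per_sol g)" unfolding eq[abs_def] by (intro continuous_intros)
  moreover have "per_sol g (t + \<omega>) = per_sol g t" for t
    using g by (simp add: eq C_per_def add.assoc[symmetric])
  ultimately show ?thesis by (simp add: C_per_def)
qed

text \<open>Moving the window from \<open>[s - \<omega>, s]\<close> to
  \<open>[t - \<omega>, t]\<close> adds \<open>J\<close> and removes the integral over
  \<open>[s - \<omega>, t - \<omega>]\<close>, which periodicity identifies with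
  \<open>S \<omega> J\<close>. The resolvent sends \<open>J - S \<omega> J\<close> back to
  \<open>J\<close>.\<close>

lemma mild_per_sol:
  assumes g: "g \<in> C_per \<omega>"
  shows "mild g (per_sol g)"
  unfolding mild_def
proof (intro allI impI)
  fix s t :: real assume "s \<le> t"
  have cont: "continuous_on UNIV g" using g by (simp add: C_per_def)
  define f where "f r = S (t - r) (g r)" for r
  have int: "f integrable_on {a..b}" if "b \<le> t" for a b
    unfolding f_def[abs_def] by (intro integrable_conv cont that)
  define J where "J = integral {s..t} f"
  have "S (t - s) (integral {s - \<omega>..s} (\<lambda>r. S (s - r) (g r))) = integral {s - \<omega>..s} f"
    using S_integral_conv[OF cont order_refl, of "t - s" "s - \<omega>" s] \<open>s \<le> t\<close> by (simp add: f_def[abs_def])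
  then have Ps: "S (t - s) (per_sol g s) = resolvent (integral {s - \<omega>..s} f)"
    using \<open>s \<le> t\<close> by (simp add: per_sol_def resolvent_S[symmetric])
  have "S \<omega> J = integral {s..t} (\<lambda>r. S (t + \<omega> - r) (g r))"
    unfolding J_def f_def[abs_def] using \<omega> by (intro S_integral_conv cont) auto
  also have "\<dots> = integral {s - \<omega>..t - \<omega>} f"
    using integral_shift_real_ivl[of s \<omega> t "\<lambda>r. S (t + \<omega> - r) (g r)"] g
    by (simp add: f_def[abs_def] C_per_def)
  finally have SJ: "S \<omega> J = integral {s - \<omega>..t - \<omega>} f" .
  have "integral {s - \<omega>..s} f + J = integral {s - \<omega>..t} f"
    unfolding J_def using \<open>s \<le> t\<close> \<omega> by (intro Henstock_Kurzweil_Integration.integral_combine int) auto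
  moreover have "integral {s - \<omega>..t - \<omega>} f + integral {t - \<omega>..t} f = integral {s - \<omega>..t} f"
    using \<open>s \<le> t\<close> \<omega> by (intro Henstock_Kurzweil_Integration.integral_combine int) auto
  ultimately have "integral {t - \<omega>..t} f = integral {s - \<omega>..s} f + (J - S \<omega> J)"
    using SJ by (simp add: algebra_simps)
  then have "per_sol g t = resolvent (integral {s - \<omega>..s} f) + (resolvent J - resolvent (S \<omega> J))"
    by (simp add: per_sol_def f_def[abs_def] blinfun.add_right blinfun.diff_right)
  then show "per_sol g t = S (t - s) (per_sol g s) + integral {s..t} (\<lambda>r. S (t - r) (g r))"
    using resolvent_eq[of J] by (simp add: Ps J_def f_def[abs_def])
qed

end

locale positive_stable_semigroup = stable_semigroup S M \<nu> \<omega>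
  for S :: "real \<Rightarrow> 'a::{banach, ordered_real_vector} \<Rightarrow>\<^sub>L 'a" and M \<nu> \<omega> +
  assumes cone: "closed {u::'a. 0 \<le> u}" and positive: "positive_semigroup S"
begin

lemma S_mono: "t \<ge> 0 \<Longrightarrow> x \<le> y \<Longrightarrow> S t x \<le> S t y"
  using positive by (metis blinfun.diff_right diff_ge_0_iff_ge positive_semigroup_def)

lemma resolvent_mono:
  assumes "x \<le> y"
  shows "resolvent x \<le> resolvent y"
proof (rule tendsto_le_cone[OF cone sequentially_bot])
  show "(\<lambda>k. \<Sum>n<k. S (real n * \<omega>) x) \<longlonglongrightarrow> resolvent x"
    and "(\<lambda>k. \<Sum>n<k. S (real n * \<omega>) y) \<longlonglongrightarrow> resolvent y"
    using resolvent_sums by (auto simp: sums_def)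
  show "eventually (\<lambda>k. (\<Sum>n<k. S (real n * \<omega>) x) \<le> (\<Sum>n<k. S (real n * \<omega>) y)) sequentially"
    using assms \<omega> by (intro always_eventually allI sum_mono S_mono) auto
qed

lemma per_sol_mono:
  assumes "continuous_on UNIV g" "continuous_on UNIV h" "g \<le> h"
  shows "per_sol g \<le> per_sol h"
  unfolding le_fun_def per_sol_def
  using assms(3)
  by (intro allI resolvent_mono integral_mono_cone cone integrable_conv assms(1,2) S_mono order_refl)
     (auto simp: le_fun_def)

end

subsection \<open>Monotone iteration\<close>

text \<open>Lower and upper solutions enter only through the inequalities \<open>lower\<close> and
  \<open>upper\<close>, so the iteration is independent of the generator and of
  differentiability.\<close>

locale monotone_iteration = positive_stable_semigroup S M \<nu> \<omega>
  for S :: "real \<Rightarrow> 'a::{banach, ordered_real_vector} \<Rightarrow>\<^sub>L 'a" and M \<nu> \<omega> +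
  fixes N \<tau> C :: real and F :: "real \<times> 'a \<times> 'a \<Rightarrow> 'a" and v\<^sub>0 w\<^sub>0 :: "real \<Rightarrow> 'a"
  assumes N: "N > 0" and normal: "\<And>x y::'a. 0 \<le> x \<Longrightarrow> x \<le> y \<Longrightarrow> norm x \<le> N * norm y"
    and wsc: "weakly_sequentially_complete (UNIV :: 'a set)"
    and cont_S: "continuous_on {0<..} S"
    and cont_F: "continuous_on UNIV F" and per_F: "\<And>t x y. F (t + \<omega>, x, y) = F (t, x, y)"
    and bound_F: "one_sided_bound \<tau> F v\<^sub>0 w\<^sub>0 C"
    and C_per: "v\<^sub>0 \<in> C_per \<omega>" "w\<^sub>0 \<in> C_per \<omega>" and v\<^sub>0_le_w\<^sub>0: "v\<^sub>0 \<le> w\<^sub>0"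
    and lower: "v\<^sub>0 \<le> per_sol (\<lambda>r. F (r, v\<^sub>0 r, v\<^sub>0 (r - \<tau>)) + C *\<^sub>R v\<^sub>0 r)"
    and upper: "per_sol (\<lambda>r. F (r, w\<^sub>0 r, w\<^sub>0 (r - \<tau>)) + C *\<^sub>R w\<^sub>0 r) \<le> w\<^sub>0"
begin

definition G :: "(real \<Rightarrow> 'a) \<Rightarrow> real \<Rightarrow> 'a" where
  "G u r = F (r, u r, u (r - \<tau>)) + C *\<^sub>R u r"

definition Q :: "(real \<Rightarrow> 'a) \<Rightarrow> real \<Rightarrow> 'a" where
  "Q u = per_sol (G u)"

definition order_interval :: "(real \<Rightarrow> 'a) set" where
  "order_interval = {u \<in> C_per \<omega>. v\<^sub>0 \<le> u \<and> u \<le> w\<^sub>0}"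

lemma order_interval_simps: "u \<in> order_interval \<longleftrightarrow> u \<in> C_per \<omega> \<and> v\<^sub>0 \<le> u \<and> u \<le> w\<^sub>0"
  by (simp add: order_interval_def)

lemma G_C_per:
  assumes "u \<in> C_per \<omega>"
  shows "G u \<in> C_per \<omega>"
proof -
  have u: "continuous_on UNIV u" using assms by (simp add: C_per_def)
  have "continuous_on UNIV (G u)"
    unfolding G_def[abs_def]
    by (intro continuous_intros continuous_on_compose2[OF cont_F] continuous_on_compose2[OF u] u) auto
  moreover have "t + \<omega> - \<tau> = (t - \<tau>) + \<omega>" for t by simp
  then have "G u (t + \<omega>) = G u t" for t
    using assms per_F unfolding G_def C_per_def by (simp only: mem_Collect_eq)
  ultimately show ?thesis by (simp add: C_per_def)
qed

lemma G_mono: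
  assumes "u \<in> order_interval" "u' \<in> order_interval" "u \<le> u'"
  shows "G u \<le> G u'"
proof (rule le_funI)
  fix t
  have "F (t, u' t, u' (t - \<tau>)) - F (t, u t, u (t - \<tau>)) \<ge> - (C *\<^sub>R (u' t - u t))"
    using bound_F assms unfolding one_sided_bound_def order_interval_simps le_fun_def by blast
  then show "G u t \<le> G u' t" by (simp add: G_def algebra_simps)
qed

lemma Q_mono: "u \<in> order_interval \<Longrightarrow> u' \<in> order_interval \<Longrightarrow> u \<le> u' \<Longrightarrow> Q u \<le> Q u'"
  unfolding Q_def using G_C_per G_mono
  by (intro per_sol_mono) (auto simp: order_interval_simps C_per_def)

lemma endpoints: "v\<^sub>0 \<in> order_interval" "w\<^sub>0 \<in> order_interval"
  using C_per v\<^sub>0_le_w\<^sub>0 by (auto simp: order_interval_simps)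

lemma endpoints_Q: "v\<^sub>0 \<le> Q v\<^sub>0" "Q w\<^sub>0 \<le> w\<^sub>0"
  using lower upper by (auto simp: Q_def G_def[abs_def])

lemma Q_order_interval:
  assumes "u \<in> order_interval"
  shows "Q u \<in> order_interval"
proof -
  have "Q v\<^sub>0 \<le> Q u" "Q u \<le> Q w\<^sub>0"
    using assms endpoints by (auto intro!: Q_mono simp: order_interval_simps)
  moreover have "Q u \<in> C_per \<omega>"
    using assms by (auto simp: Q_def order_interval_simps intro: per_sol_C_per G_C_per)
  ultimately show ?thesis using endpoints_Q by (auto simp: order_interval_simps)
qed

lemma iterate_order_interval: "u \<in> order_interval \<Longrightarrow> (Q ^^ i) u \<in> order_interval"
  by (induction i) (auto intro: Q_order_interval)

lemma iterate_mono:
  assumes "u \<in> order_interval" "u' \<in> order_interval" "u \<le> u'"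
  shows "(Q ^^ i) u \<le> (Q ^^ i) u'"
  by (induction i) (use assms in \<open>auto intro!: Q_mono iterate_order_interval\<close>)

lemma iterate_Suc: "(Q ^^ Suc i) u = (Q ^^ i) (Q u)"
  by (simp add: funpow_swap1)

lemma iterate_fixpoint: "Q u = u \<Longrightarrow> (Q ^^ i) u = u"
  by (induction i) auto

text \<open>The endpoints are arbitrary because the bound is applied twice: between
  \<open>v\<^sub>0\<close> and \<open>w\<^sub>0\<close> for the iterates, and between
  \<open>G v\<^sub>0\<close> and \<open>G w\<^sub>0\<close> for the right-hand sides, which are thus
  bounded by order instead of by growth of \<open>F\<close>.\<close>

lemma order_interval_bounded:
  fixes a b :: "real \<Rightarrow> 'a"
  assumes "a \<in> C_per \<omega>" "b \<in> C_per \<omega>"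
  shows "\<exists>K. \<forall>u t. a \<le> u \<and> u \<le> b \<longrightarrow> norm (u t) \<le> K"
proof -
  obtain K1 K2 where K: "\<And>t. norm (a t) \<le> K1" "\<And>t. norm (b t) \<le> K2"
    using C_per_bounded[OF assms(1) \<omega>] C_per_bounded[OF assms(2) \<omega>] by blast
  have "norm (u t) \<le> K1 + N * (K2 + K1)" if "a \<le> u" "u \<le> b" for u t
  proof -
    have "0 \<le> u t - a t" "u t - a t \<le> b t - a t" using that by (auto simp: le_fun_def)
    then have "norm (u t - a t) \<le> N * norm (b t - a t)" by (rule normal)
    also have "\<dots> \<le> N * (K2 + K1)"
      using N by (intro mult_left_mono order_trans[OF norm_triangle_ineq4] add_mono K) auto
    finally show ?thesis using norm_triangle_ineq[of "a t" "u t - a t"] K(1)[of t] by simp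
  qed
  then show ?thesis by blast
qed

lemma iterates_converge:
  assumes x0: "x 0 \<in> order_interval" and x_Suc: "\<And>i. x (Suc i) = Q (x i)"
    and conv: "\<And>t. convergent (\<lambda>i. x i t)"
  shows "\<exists>u \<in> order_interval. Q u = u \<and> converges_in_C_per \<omega> x u \<and> (\<forall>t. (\<lambda>i. x i t) \<longlonglongrightarrow> u t)"
proof -
  have x: "x i \<in> order_interval" for i by (induction i) (auto simp: x0 x_Suc intro: Q_order_interval)
  then have x_per: "x i \<in> C_per \<omega>" for i by (simp add: order_interval_simps)
  have x_mild: "mild (G (x i)) (x (Suc i))" for i
    unfolding x_Suc Q_def by (intro mild_per_sol G_C_per x_per)
  have G_cont: "continuous_on UNIV (G (x i))" for i
    using G_C_per[OF x_per] by (simp add: C_per_def)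
  define u where "u t = lim (\<lambda>i. x i t)" for t
  have lim: "(\<lambda>i. x i t) \<longlonglongrightarrow> u t" for t
    using conv[of t] by (simp add: u_def convergent_LIMSEQ_iff)
  obtain K1 K2 where K1: "\<And>u t. v\<^sub>0 \<le> u \<Longrightarrow> u \<le> w\<^sub>0 \<Longrightarrow> norm (u t) \<le> K1"
    and K2: "\<And>u t. G v\<^sub>0 \<le> u \<Longrightarrow> u \<le> G w\<^sub>0 \<Longrightarrow> norm (u t) \<le> K2"
    using order_interval_bounded[OF C_per] order_interval_bounded[OF G_C_per G_C_per, OF C_per] by blast
  have "norm (x i t) \<le> max K1 K2" for i t
    using K1[of "x i" t] x[of i] by (auto simp: order_interval_simps)
  moreover have "norm (G (x i) t) \<le> max K1 K2" for i t
    using K2[of "G (x i)" t] G_mono[OF endpoints(1) x] G_mono[OF x endpoints(2)] x[of i]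
    by (auto simp: order_interval_simps)
  \<comment> \<open>The index starts at 1: \<open>x 0\<close> is merely a member of the order
    interval, while every later term is a mild solution with a bounded right-hand side.\<close>
  ultimately have equi: "\<exists>d>0. \<forall>i s t. dist s t < d \<longrightarrow> dist (x (Suc i) s) (x (Suc i) t) < e"
    if "e > 0" for e
    using that by (intro mild_equicontinuous[OF cont_S G_cont x_mild, where K = "max K1 K2"])
  note unif = equicontinuous_pointwise_uniform_limit[of sequentially "\<lambda>i. x (Suc i)" u,
      OF sequentially_bot equi LIMSEQ_Suc[OF lim]]
  have u_cont: "continuous_on UNIV u" by (rule unif(1)[OF _ compact_Icc])
  have x_unif: "uniform_limit {a..b} (\<lambda>i. x (Suc i)) u sequentially" for a b
    by (rule unif(2)[OF _ compact_Icc])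
  have "u (t + \<omega>) = u t" for t using x_per by (simp add: u_def C_per_def)
  with u_cont have u_per: "u \<in> C_per \<omega>" by (simp add: C_per_def)
  have "v\<^sub>0 t \<le> u t" "u t \<le> w\<^sub>0 t" for t
    using x by (auto simp: order_interval_simps le_fun_def
        intro!: tendsto_le_cone[OF cone sequentially_bot tendsto_const lim]
          tendsto_le_cone[OF cone sequentially_bot lim tendsto_const])
  with u_per have u: "u \<in> order_interval" by (simp add: order_interval_simps le_fun_def)
  have G_unif: "uniform_limit {a..b} (\<lambda>i. G (x (Suc i))) (G u) sequentially" for a b
  proof -
    have delay: "uniform_limit {a..b} (\<lambda>i t. x (Suc i) (t - \<tau>)) (\<lambda>t. u (t - \<tau>)) sequentially"
      by (rule uniform_limit_compose'[OF x_unif[of "a - \<tau>" "b - \<tau>"]]) auto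
    have "uniform_limit {a..b} (\<lambda>i t. F (t, x (Suc i) t, x (Suc i) (t - \<tau>))) (\<lambda>t. F (t, u t, u (t - \<tau>))) sequentially"
    \<comment> \<open>Compactness is asked only of the graph of the limit and its delay over
      \<open>[a, b]\<close>, which the corresponding graphs of the iterates approach
      uniformly.\<close>
    proof (rule uniform_limit_compose_near_compact[OF cont_F])
      show "compact ((\<lambda>t. (t, u t, u (t - \<tau>))) ` {a..b})"
        by (intro compact_continuous_image continuous_intros continuous_on_compose2[OF u_cont]) auto
    qed (intro uniform_limit_Pair uniform_limit_const x_unif delay)
    then show ?thesis unfolding G_def[abs_def]
      by (intro uniform_limit_add bounded_linear.uniform_limit[OF bounded_linear_scaleR_right] x_unif)
  qed
  have "mild (G u) u"
    by (rule mild_uniform_limit[of "\<lambda>i. G (x (Suc i))" "\<lambda>i. x (Suc (Suc i))"])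
       (intro G_cont x_mild LIMSEQ_Suc lim G_unif)+
  then have "Q u = u" unfolding Q_def using per_sol_unique u_per by metis
  moreover have "converges_in_C_per \<omega> x u"
  proof (rule converges_in_C_per_uniform[OF x_per u_per \<omega>])
    show "uniform_limit {0..\<omega>} x u sequentially"
      using x_unif[of 0 \<omega>] filterlim_sequentially_Suc[of x] by (simp add: filterlim_sequentially_Suc)
  qed
  ultimately show ?thesis using u lim by blast
qed

lemma pointwise_monotone_convergent:
  assumes "\<And>i. x i \<in> order_interval" and "(\<forall>i. x i \<le> x (Suc i)) \<or> (\<forall>i. x (Suc i) \<le> x i)"
  shows "convergent (\<lambda>i. x i t)"
  using assms(2)
proof
  assume "\<forall>i. x i \<le> x (Suc i)"
  then show ?thesis
    using assms(1) by (intro monotone_bounded_convergent[OF cone normal N wsc, of _ "w\<^sub>0 t"])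
      (auto simp: incseq_Suc_iff le_fun_def order_interval_simps)
next
  assume "\<forall>i. x (Suc i) \<le> x i"
  then have "convergent (\<lambda>i. - x i t)"
    using assms(1) by (intro monotone_bounded_convergent[OF cone normal N wsc, of _ "- v\<^sub>0 t"])
      (auto simp: incseq_Suc_iff le_fun_def order_interval_simps)
  then show ?thesis using convergent_minus_iff by blast
qed

theorem extremal_fixpoints:
  "\<exists>u_min u_max. u_min \<in> order_interval \<and> Q u_min = u_min \<and> u_max \<in> order_interval \<and> Q u_max = u_max \<and>
     u_min \<le> u_max \<and> (\<forall>u\<in>order_interval. Q u = u \<longrightarrow> u_min \<le> u \<and> u \<le> u_max) \<and>
     (\<forall>i. (Q ^^ i) v\<^sub>0 \<le> (Q ^^ Suc i) v\<^sub>0 \<and> (Q ^^ i) v\<^sub>0 \<le> (Q ^^ i) w\<^sub>0 \<and> (Q ^^ Suc i) w\<^sub>0 \<le> (Q ^^ i) w\<^sub>0) \<and>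
     converges_in_C_per \<omega> (\<lambda>i. (Q ^^ i) v\<^sub>0) u_min \<and> converges_in_C_per \<omega> (\<lambda>i. (Q ^^ i) w\<^sub>0) u_max"
proof -
  have mono: "(Q ^^ i) v\<^sub>0 \<le> (Q ^^ Suc i) v\<^sub>0" "(Q ^^ i) v\<^sub>0 \<le> (Q ^^ i) w\<^sub>0" "(Q ^^ Suc i) w\<^sub>0 \<le> (Q ^^ i) w\<^sub>0" for i
    unfolding iterate_Suc
    by (intro iterate_mono endpoints endpoints_Q Q_order_interval v\<^sub>0_le_w\<^sub>0)+
  have "\<exists>u \<in> order_interval. Q u = u \<and> converges_in_C_per \<omega> (\<lambda>i. (Q ^^ i) v\<^sub>0) u \<and> (\<forall>t. (\<lambda>i. (Q ^^ i) v\<^sub>0 t) \<longlonglongrightarrow> u t)"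
    using endpoints mono by (intro iterates_converge pointwise_monotone_convergent iterate_order_interval) auto
  then obtain u_min where u_min: "u_min \<in> order_interval" "Q u_min = u_min"
      "converges_in_C_per \<omega> (\<lambda>i. (Q ^^ i) v\<^sub>0) u_min" and min_lim: "\<And>t. (\<lambda>i. (Q ^^ i) v\<^sub>0 t) \<longlonglongrightarrow> u_min t" by blast
  have "\<exists>u \<in> order_interval. Q u = u \<and> converges_in_C_per \<omega> (\<lambda>i. (Q ^^ i) w\<^sub>0) u \<and> (\<forall>t. (\<lambda>i. (Q ^^ i) w\<^sub>0 t) \<longlonglongrightarrow> u t)"
    using endpoints mono by (intro iterates_converge pointwise_monotone_convergent iterate_order_interval) auto
  then obtain u_max where u_max: "u_max \<in> order_interval" "Q u_max = u_max"
      "converges_in_C_per \<omega> (\<lambda>i. (Q ^^ i) w\<^sub>0) u_max" and max_lim: "\<And>t. (\<lambda>i. (Q ^^ i) w\<^sub>0 t) \<longlonglongrightarrow> u_max t" by blast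
  \<comment> \<open>A fixed point is its own iterate, so it stays between the two sequences at every
    stage and the inequalities pass to the limits.\<close>
  have between: "u_min \<le> u \<and> u \<le> u_max" if "u \<in> order_interval" "Q u = u" for u
  proof -
    have "(Q ^^ i) v\<^sub>0 \<le> (Q ^^ i) u" "(Q ^^ i) u \<le> (Q ^^ i) w\<^sub>0" for i
      using that(1) endpoints by (auto intro!: iterate_mono simp: order_interval_simps)
    then have "(Q ^^ i) v\<^sub>0 t \<le> u t" "u t \<le> (Q ^^ i) w\<^sub>0 t" for i t
      using iterate_fixpoint[OF that(2)] by (auto simp: le_fun_def)
    then show ?thesis
      by (auto simp: le_fun_def intro!: always_eventually
          tendsto_le_cone[OF cone sequentially_bot min_lim tendsto_const]
          tendsto_le_cone[OF cone sequentially_bot tendsto_const max_lim])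
  qed
  show ?thesis
    by (intro exI[of _ u_min] exI[of _ u_max] conjI allI ballI impI u_min u_max mono)
       (use between u_max in auto)
qed

end

section \<open>From the delayed equation to the abstract iteration\<close>

text \<open>Taking the residual \<open>h\<close> as right-hand side makes any strict lower or upper
  solution an exact mild solution, so differential inequalities become inequalities between
  right-hand sides. Continuity into the graph norm makes \<open>h\<close> continuous.\<close>

lemma strict_solution_mild:
  assumes C1: "v \<in> C1_per \<omega>" and graph: "v \<in> C_per_graph \<omega> D A"
    and A: "closed_linear_operator D A" and gen: "generates D (\<lambda>x. - A x) T"
    and T: "c0_semigroup T M \<nu>"
  defines "h \<equiv> \<lambda>r. vector_derivative v (at r) + A (v r)"
  shows "continuous_on UNIV h" and "c0_semigroup.mild T h v"
proof -
  obtain v' where v': "\<And>r. (v has_vector_derivative v' r) (at r)" and "continuous_on UNIV v'"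
    using C1 by (auto simp: C1_per_def C1_differentiable_on_def)
  then have h: "h r = v' r - (- A (v r))" for r using vector_derivative_at[OF v'] by (simp add: h_def)
  have D: "v r \<in> D" for r using graph by (auto simp: C_per_graph_def)
  have "A (v s - v t) = A (v s) - A (v t)" for s t
  proof -
    have "A (v s + (- 1) *\<^sub>R v t) = A (v s) + (- 1) *\<^sub>R A (v t)"
      using A D unfolding closed_linear_operator_def by (metis subspace_scale)
    then show ?thesis by simp
  qed
  then have "norm (A (v s) - A (v t)) \<le> graph_norm A (v s - v t)" for s t
    by (simp add: graph_norm_def)
  moreover have "((\<lambda>s. graph_norm A (v s - v t)) \<longlongrightarrow> 0) (at t)" for t
    using graph by (auto simp: C_per_graph_def)
  ultimately have "((\<lambda>s. A (v s) - A (v t)) \<longlongrightarrow> 0) (at t)" for t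
    by (rule Lim_null_comparison[OF always_eventually[OF allI]])
  then have "continuous_on UNIV (\<lambda>r. A (v r))"
    by (auto simp: continuous_on_def LIM_zero_iff)
  with \<open>continuous_on UNIV v'\<close> show "continuous_on UNIV h"
    unfolding h[abs_def] by (intro continuous_intros)
  show "c0_semigroup.mild T h v"
    unfolding h[abs_def] by (rule c0_semigroup.mild_of_strict[OF T gen D v'])
qed

lemma positive_shifted_semigroup: "positive_semigroup T \<Longrightarrow> positive_semigroup (shifted_semigroup C T)"
  by (auto simp: positive_semigroup_def shifted_semigroup_def blinfun.scaleR_left intro!: scaleR_nonneg_nonneg)

lemma shifted_shifted_semigroup: "shifted_semigroup (- C) (shifted_semigroup C T) = T"
  by (auto simp: shifted_semigroup_def mult_exp_exp)

lemma one_sided_bound_mono: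
  fixes F :: "real \<times> 'a \<times> 'a \<Rightarrow> 'a::{banach, ordered_real_vector}"
  assumes "one_sided_bound \<tau> F v w C" and "C \<le> C'"
  shows "one_sided_bound \<tau> F v w C'"
proof -
  have "- (C' *\<^sub>R (x' - x)) \<le> - (C *\<^sub>R (x' - x))" if "x \<le> x'" for x x' :: 'a
    using that \<open>C \<le> C'\<close> by (intro le_imp_neg_le scaleR_right_mono) auto
  then show ?thesis using assms(1) unfolding one_sided_bound_def by (meson order_trans)
qed

text \<open>The case of one fixed \<open>C\<close>. Its first conjunct does not mention
  \<open>C\<close>, because the fixed points of \<open>Q\<close> are exactly the periodic mild
  solutions for \<open>T\<close>.\<close>

lemma monotone_iteration_of_bound:
  fixes D :: "'a::{banach, ordered_real_vector} set"
  assumes cone: "closed {u::'a. u \<ge> 0}" and normal: "normal_cone {u::'a. u \<ge> 0}"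
    and wsc: "weakly_sequentially_complete (UNIV :: 'a set)" and "\<omega> > 0"
    and A: "closed_linear_operator D A" and T: "C0_semigroup T" and gen: "generates D (\<lambda>x. - A x) T"
    and pos: "positive_semigroup T" and equi: "equicontinuous_semigroup T"
    and F: "continuous_on UNIV F" "\<And>t x y. F (t + \<omega>, x, y) = F (t, x, y)"
    and v: "lower_solution \<omega> \<tau> D A F v\<^sub>0" and w: "upper_solution \<omega> \<tau> D A F w\<^sub>0" and "v\<^sub>0 \<le> w\<^sub>0"
    and C: "one_sided_bound \<tau> F v\<^sub>0 w\<^sub>0 C" "growth_exponent T < ereal C"
  shows "\<exists>u_min u_max. minimal_maximal_mild_solutions \<omega> \<tau> T F v\<^sub>0 w\<^sub>0 u_min u_max \<and>
      (let v = (\<lambda>i. (Q_op \<omega> \<tau> T F C ^^ i) v\<^sub>0);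
           w = (\<lambda>i. (Q_op \<omega> \<tau> T F C ^^ i) w\<^sub>0)
         in (\<forall>i. v i \<le> v (Suc i) \<and> v i \<le> w i \<and> w (Suc i) \<le> w i) \<and>
            converges_in_C_per \<omega> v u_min \<and>
            converges_in_C_per \<omega> w u_max)"
proof -
  \<comment> \<open>An infimum below \<open>C\<close> provides an admissible rate strictly below
    \<open>C\<close>, which makes the shifted rate \<open>\<nu> - C\<close> negative.\<close>
  obtain \<nu> M where "\<nu> < C" "M \<ge> 1" and bound: "\<And>t. t \<ge> 0 \<Longrightarrow> norm (T t) \<le> M * exp (\<nu> * t)"
    using C(2) by (auto simp: growth_exponent_def Inf_less_iff)
  interpret T: c0_semigroup T M \<nu>
    by unfold_locales (use T \<open>M \<ge> 1\<close> bound in auto)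
  define S where "S = shifted_semigroup C T"
  interpret S: c0_semigroup S M "\<nu> - C" unfolding S_def by (rule T.shifted)
  interpret S: positive_stable_semigroup S M "\<nu> - C" \<omega>
    by unfold_locales (use \<open>\<nu> < C\<close> \<open>\<omega> > 0\<close> cone positive_shifted_semigroup[OF pos] in \<open>auto simp: S_def\<close>)
  have per: "v\<^sub>0 \<in> C_per \<omega>" "w\<^sub>0 \<in> C_per \<omega>"
    using v w by (auto simp: lower_solution_def upper_solution_def C1_per_def)
  have F_cont: "continuous_on UNIV (\<lambda>r. F (r, u r, u (r - \<tau>)))" if "u \<in> C_per \<omega>" for u
  proof -
    have u: "continuous_on UNIV u" using that by (simp add: C_per_def)
    show ?thesis
      by (intro continuous_intros continuous_on_compose2[OF F(1)] continuous_on_compose2[OF u] u) auto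
  qed
  have G_cont: "continuous_on UNIV (\<lambda>r. F (r, u r, u (r - \<tau>)) + C *\<^sub>R u r)" if "u \<in> C_per \<omega>" for u
    using that by (intro continuous_on_add F_cont continuous_on_scaleR continuous_on_const) (simp_all add: C_per_def)
  have strict: "\<exists>h. continuous_on UNIV h \<and> u = S.per_sol h \<and>
      (\<forall>t. h t = vector_derivative u (at t) + A (u t) + C *\<^sub>R u t)"
    if u: "u \<in> C1_per \<omega>" "u \<in> C_per_graph \<omega> D A" for u
  proof -
    have up: "u \<in> C_per \<omega>" using u(1) by (simp add: C1_per_def)
    then have uc: "continuous_on UNIV u" by (simp add: C_per_def)
    note h = strict_solution_mild[OF u A gen T.c0_semigroup_axioms]
    have "u = S.per_sol (\<lambda>r. vector_derivative u (at r) + A (u r) + C *\<^sub>R u r)"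
      using T.mild_shifted[OF h(1) uc h(2), of C] up by (intro S.per_sol_unique) (simp_all add: S_def)
    with h(1) uc show ?thesis by (intro exI conjI) (auto intro!: continuous_intros)
  qed
  have "v\<^sub>0 \<le> S.per_sol (\<lambda>r. F (r, v\<^sub>0 r, v\<^sub>0 (r - \<tau>)) + C *\<^sub>R v\<^sub>0 r)"
  proof -
    obtain h where h: "continuous_on UNIV h" "v\<^sub>0 = S.per_sol h"
      "\<And>t. h t = vector_derivative v\<^sub>0 (at t) + A (v\<^sub>0 t) + C *\<^sub>R v\<^sub>0 t"
      using strict[of v\<^sub>0] v by (auto simp: lower_solution_def)
    have "S.per_sol h \<le> S.per_sol (\<lambda>r. F (r, v\<^sub>0 r, v\<^sub>0 (r - \<tau>)) + C *\<^sub>R v\<^sub>0 r)"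
      using v by (intro S.per_sol_mono h(1) G_cont per) (auto simp: le_fun_def h(3) lower_solution_def)
    then show ?thesis by (subst h(2))
  qed
  moreover have "S.per_sol (\<lambda>r. F (r, w\<^sub>0 r, w\<^sub>0 (r - \<tau>)) + C *\<^sub>R w\<^sub>0 r) \<le> w\<^sub>0"
  proof -
    obtain h where h: "continuous_on UNIV h" "w\<^sub>0 = S.per_sol h"
      "\<And>t. h t = vector_derivative w\<^sub>0 (at t) + A (w\<^sub>0 t) + C *\<^sub>R w\<^sub>0 t"
      using strict[of w\<^sub>0] w by (auto simp: upper_solution_def)
    have "S.per_sol (\<lambda>r. F (r, w\<^sub>0 r, w\<^sub>0 (r - \<tau>)) + C *\<^sub>R w\<^sub>0 r) \<le> S.per_sol h"
      using w by (intro S.per_sol_mono h(1) G_cont per) (auto simp: le_fun_def h(3) upper_solution_def)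
    then show ?thesis by (subst (2) h(2))
  qed
  moreover obtain N where "N > 0" "\<And>x y::'a. 0 \<le> x \<Longrightarrow> x \<le> y \<Longrightarrow> norm x \<le> N * norm y"
    using normal by (auto simp: normal_cone_def)
  moreover have "continuous_on {0<..} S"
    using equi by (auto simp: S_def shifted_semigroup_def[abs_def] equicontinuous_semigroup_def intro!: continuous_intros)
  ultimately interpret I: monotone_iteration S M "\<nu> - C" \<omega> N \<tau> C F v\<^sub>0 w\<^sub>0
    using wsc F C(1) per \<open>v\<^sub>0 \<le> w\<^sub>0\<close> by unfold_locales
  have Q: "Q_op \<omega> \<tau> T F C = I.Q"
    by (intro ext) (simp add: Q_op_def I.Q_def S.per_sol_def I.G_def S.inv_eq_resolvent S_def[symmetric])
  have mild_iff: "mild_solution \<omega> \<tau> T F u \<longleftrightarrow> u \<in> C_per \<omega> \<and> I.Q u = u" for u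
  proof (cases "u \<in> C_per \<omega>")
    case True
    then have uc: "continuous_on UNIV u" by (simp add: C_per_def)
    have "T.mild (\<lambda>r. F (r, u r, u (r - \<tau>))) u \<longleftrightarrow> S.mild (I.G u) u"
    proof
      assume "T.mild (\<lambda>r. F (r, u r, u (r - \<tau>))) u"
      from T.mild_shifted[OF F_cont[OF True] uc this, of C]
      show "S.mild (I.G u) u" by (simp add: S_def I.G_def[abs_def])
    next
      assume "S.mild (I.G u) u"
      then have "S.mild (\<lambda>r. F (r, u r, u (r - \<tau>)) + C *\<^sub>R u r) u" by (simp add: I.G_def[abs_def])
      \<comment> \<open>Shifting by \<open>- C\<close> turns \<open>S\<close> back into
        \<open>T\<close> and cancels the term \<open>C *\<^sub>R u r\<close> in the right-hand
        side.\<close>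
      from S.mild_shifted[OF G_cont[OF True] uc this, of "- C"]
      show "T.mild (\<lambda>r. F (r, u r, u (r - \<tau>))) u"
        by (simp add: S_def shifted_shifted_semigroup)
    qed
    also have "\<dots> \<longleftrightarrow> I.Q u = u"
      using S.per_sol_unique[OF _ True] S.mild_per_sol[OF I.G_C_per[OF True]] unfolding I.Q_def by metis
    finally show ?thesis using True by (simp add: mild_solution_def T.mild_def)
  qed (simp add: mild_solution_def)
  obtain u_min u_max where
    u: "u_min \<in> I.order_interval" "I.Q u_min = u_min" "u_max \<in> I.order_interval" "I.Q u_max = u_max" "u_min \<le> u_max"
      "\<forall>u\<in>I.order_interval. I.Q u = u \<longrightarrow> u_min \<le> u \<and> u \<le> u_max"
    and it: "(\<forall>i. (I.Q ^^ i) v\<^sub>0 \<le> (I.Q ^^ Suc i) v\<^sub>0 \<and> (I.Q ^^ i) v\<^sub>0 \<le> (I.Q ^^ i) w\<^sub>0 \<and> (I.Q ^^ Suc i) w\<^sub>0 \<le> (I.Q ^^ i) w\<^sub>0) \<and>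
     converges_in_C_per \<omega> (\<lambda>i. (I.Q ^^ i) v\<^sub>0) u_min \<and> converges_in_C_per \<omega> (\<lambda>i. (I.Q ^^ i) w\<^sub>0) u_max"
    using I.extremal_fixpoints by blast
  have "minimal_maximal_mild_solutions \<omega> \<tau> T F v\<^sub>0 w\<^sub>0 u_min u_max"
    using u by (auto simp: minimal_maximal_mild_solutions_def mild_iff I.order_interval_simps)
  from conjI[OF this it] show ?thesis unfolding Q Let_def by (intro exI)
qed

text \<open>This allows the pair to be fixed before \<open>C\<close> is quantified: the limits
  obtained for different \<open>C\<close> must coincide.\<close>

lemma minimal_maximal_unique:
  assumes "minimal_maximal_mild_solutions \<omega> \<tau> T F v w a b" "minimal_maximal_mild_solutions \<omega> \<tau> T F v w a' b'"
  shows "a = a'" "b = b'"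
proof -
  have "a \<le> w" "b \<ge> v" "a' \<le> w" "b' \<ge> v"
    using assms by (auto simp: minimal_maximal_mild_solutions_def intro: order_trans)
  then show "a = a'" "b = b'"
    using assms unfolding minimal_maximal_mild_solutions_def by (auto intro!: antisym)
qed

text \<open>Guarantees that some real \<open>C\<close> exceeds the growth exponent. Only an upper
  bound is given, since the exponent may be \<open>-\<infinity>\<close>.\<close>

lemma growth_exponent_finite:
  fixes T :: "real \<Rightarrow> 'a::banach \<Rightarrow>\<^sub>L 'a"
  assumes "C0_semigroup T"
  shows "\<exists>\<nu>. growth_exponent T \<le> ereal \<nu>"
proof -
  obtain M \<nu> where "M \<ge> 1" "\<forall>t\<ge>0. norm (T t) \<le> M * exp (\<nu> * t)"
    using C0_semigroup_exp_bound[OF assms] by blast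
  then have "growth_exponent T \<le> ereal \<nu>" unfolding growth_exponent_def by (intro Inf_lower) blast
  then show ?thesis ..
qed

theorem theorem3p3:
  fixes \<omega> \<tau> :: real
    and D :: "'a::{banach, ordered_real_vector} set"
    and A :: "'a \<Rightarrow> 'a"
    and T :: "real \<Rightarrow> 'a \<Rightarrow>\<^sub>L 'a"
    and F :: "real \<times> 'a \<times> 'a \<Rightarrow> 'a"
    and v\<^sub>0 w\<^sub>0 :: "real \<Rightarrow> 'a"
  assumes "closed {u::'a. u \<ge> 0}"
    and "normal_cone {u::'a. u \<ge> 0}"
    and "weakly_sequentially_complete (UNIV :: 'a set)"
    and "\<omega> > 0" and "\<tau> > 0"
    and "closed_linear_operator D A"
    and "C0_semigroup T"
    and "generates D (\<lambda>x. - A x) T"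
    and "positive_semigroup T"
    and "equicontinuous_semigroup T"
    and "continuous_on UNIV F"
    and "\<And>t x y. F (t + \<omega>, x, y) = F (t, x, y)"
    and "lower_solution \<omega> \<tau> D A F v\<^sub>0"
    and "upper_solution \<omega> \<tau> D A F w\<^sub>0"
    and "v\<^sub>0 \<le> w\<^sub>0"
    and "\<exists>C\<ge>0. one_sided_bound \<tau> F v\<^sub>0 w\<^sub>0 C"
  shows "\<exists>u_min u_max.
      minimal_maximal_mild_solutions \<omega> \<tau> T F v\<^sub>0 w\<^sub>0 u_min u_max \<and>
      (\<forall>C\<ge>0. one_sided_bound \<tau> F v\<^sub>0 w\<^sub>0 C \<and> growth_exponent T < ereal C \<longrightarrow>
        (let v = (\<lambda>i. (Q_op \<omega> \<tau> T F C ^^ i) v\<^sub>0);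
             w = (\<lambda>i. (Q_op \<omega> \<tau> T F C ^^ i) w\<^sub>0)
         in (\<forall>i. v i \<le> v (Suc i) \<and> v i \<le> w i \<and> w (Suc i) \<le> w i) \<and>
            converges_in_C_per \<omega> v u_min \<and>
            converges_in_C_per \<omega> w u_max))"
proof -
  note iteration = monotone_iteration_of_bound[OF assms(1-4,6-15)]
  obtain C0 \<nu> where C0: "one_sided_bound \<tau> F v\<^sub>0 w\<^sub>0 C0" and \<nu>: "growth_exponent T \<le> ereal \<nu>"
    using assms(16) growth_exponent_finite[OF assms(7)] by blast
  \<comment> \<open>Enlarging \<open>C0\<close> preserves the one-sided bound, and the added 1 makes
    the inequality with the growth exponent strict.\<close>
  define C where "C = max C0 (\<nu> + 1)"
  have "one_sided_bound \<tau> F v\<^sub>0 w\<^sub>0 C" using C0 by (rule one_sided_bound_mono) (simp add: C_def)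
  moreover have "\<nu> < C" by (simp add: C_def)
  then have "growth_exponent T < ereal C" using \<nu> by (simp add: order_le_less_trans)
  ultimately obtain u_min u_max where u: "minimal_maximal_mild_solutions \<omega> \<tau> T F v\<^sub>0 w\<^sub>0 u_min u_max"
    using iteration by blast
  show ?thesis
  proof (intro exI[of _ u_min] exI[of _ u_max] conjI[OF u] allI impI, elim conjE)
    fix C' assume C': "one_sided_bound \<tau> F v\<^sub>0 w\<^sub>0 C'" "growth_exponent T < ereal C'"
    from iteration[OF this] minimal_maximal_unique[OF u]
    show "let v = (\<lambda>i. (Q_op \<omega> \<tau> T F C' ^^ i) v\<^sub>0);
             w = (\<lambda>i. (Q_op \<omega> \<tau> T F C' ^^ i) w\<^sub>0)
         in (\<forall>i. v i \<le> v (Suc i) \<and> v i \<le> w i \<and> w (Suc i) \<le> w i) \<and>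
            converges_in_C_per \<omega> v u_min \<and> converges_in_C_per \<omega> w u_max"
      by blast
  qed
qed

end
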